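(* Let $k$ be an algebraically closed field of any characteristic, $m\geq 1$, and let $V$ be a finite-dimensional module over $k\,pRo_m$, where $pRo_m$ is the planar rook monoid, with (Brauer) character $\chi$. Let $l(n)$ be the composition length of $V^{\otimes n}$ and $b(n)$ the number of its indecomposable direct summands (with multiplicity), $n\ge1$. (a) For $0\le l\le m$, $$[V^{\otimes n}:V_l]=\sum_{j=0}^l(-1)^{l-j}\binom lj(\chi(j))^n,$$ and so $$l(n)=b(n)=\sum_{l=0}^m\sum_{j=0}^l(-1)^{l-j}\binom lj(\chi(j))^n.$$ (b) If $V=V_i$ ($0\le i\le m$), then $l(n)\sim k(n)=(\dim V)^n=\binom mi^n$, $\ |l(n)/k(n)-1|\in\mathcal O\big((\tfrac{m-i}{m})^n\big)$, and $|l(n)-k(n)|\in\mathcal O\big(\binom{m-1}{i}^n\big)$.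
   Context: The planar rook monoid $pRo_m$ is the monoid of diagrams on $m$ top and $m$ bottom vertices in which each vertex is either isolated or joined to exactly one vertex of the opposite row, with no crossings (equivalently, order-preserving partial injections of $\{1,\dots,m\}$). The product is by stacking and discarding components not touching the boundary. The $\mathcal J$-classes are indexed by the number $j\in\{0,\dots,m\}$ of through strands (blocks joining top to bottom), each contains an idempotent $e_j$, and all maximal subgroups are trivial. $\chi(j)$ is the value of $\chi$ on the $j$-th $\mathcal J$-class, i.e. $\chi(j)=\dim_k e_jV$. $V_l$ is the simple module with apex the $l$-th $\mathcal J$-class: $e_lV_l\ne0$ and all diagrams with fewer than $l$ through strands annihilate $V_l$. $[W:S]$ is the multiplicity of $S$ as a composition factor of $W$. Modules are unital left modules, tensor powers carry the diagonal action, and $f\sim g$ means $f(n)/g(n)\to1$ as $n\to\infty$. *)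

theory Defs
  imports
    Complex_Main
    "HOL-Computational_Algebra.Polynomial"
    "HOL-Library.Function_Algebras"
    "HOL-Library.Landau_Symbols"
begin

section \<open>The planar rook monoid\<close>

text \<open>A planar rook diagram is the partial map that sends a bottom vertex to the top vertex it is
  joined to.  Stacking \<open>s\<close> on top of \<open>t\<close> and discarding the components that do not touch the
  boundary is then the composition \<open>s \<circ>\<^sub>m t\<close> of partial maps.\<close>

definition planar_rook :: "nat \<Rightarrow> (nat \<rightharpoonup> nat) set" where
  "planar_rook m = {s. dom s \<subseteq> {1..m} \<and> ran s \<subseteq> {1..m} \<and> inj_on s (dom s) \<and>
     (\<forall>x y a b. s x = Some a \<and> s y = Some b \<and> x \<le> y \<longrightarrow> a \<le> b)}"

definition prook_one :: "nat \<Rightarrow> nat \<rightharpoonup> nat" where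
  "prook_one m = (\<lambda>x. if x \<in> {1..m} then Some x else None)"

definition strands :: "(nat \<rightharpoonup> nat) \<Rightarrow> nat" where
  "strands s = card (dom s)"

definition idempotent_in_class :: "nat \<Rightarrow> nat \<Rightarrow> (nat \<rightharpoonup> nat) \<Rightarrow> bool" where
  "idempotent_in_class m j e \<longleftrightarrow> e \<in> planar_rook m \<and> e \<circ>\<^sub>m e = e \<and> strands e = j"


section \<open>Modules\<close>

text \<open>A left module over the monoid algebra is a vector space with a unital linear action of the
  monoid.  The vector space is a subspace \<^term>\<open>mcarrier M\<close> of an ambient vector space, which is
  the whole type \<open>'v\<close>; outside the carrier the action is irrelevant.\<close>

record ('k, 'v) pmod =
  mcarrier :: "'v set"
  mscale :: "'k \<Rightarrow> 'v \<Rightarrow> 'v"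
  mact :: "(nat \<rightharpoonup> nat) \<Rightarrow> 'v \<Rightarrow> 'v"

definition lin_on ::
  "('k, 'v::ab_group_add) pmod \<Rightarrow> ('k \<Rightarrow> 'w::ab_group_add \<Rightarrow> 'w) \<Rightarrow> ('v \<Rightarrow> 'w) \<Rightarrow> bool" where
  "lin_on M scale f \<longleftrightarrow>
     (\<forall>u\<in>mcarrier M. \<forall>v\<in>mcarrier M. f (u + v) = f u + f v) \<and>
     (\<forall>c. \<forall>v\<in>mcarrier M. f (mscale M c v) = scale c (f v))"

definition is_module :: "nat \<Rightarrow> ('k::field, 'v::ab_group_add) pmod \<Rightarrow> bool" where
  "is_module m M \<longleftrightarrow>
     vector_space (mscale M) \<and> module.subspace (mscale M) (mcarrier M) \<and>
     (\<forall>s\<in>planar_rook m. mact M s ` mcarrier M \<subseteq> mcarrier M \<and> lin_on M (mscale M) (mact M s)) \<and>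
     (\<forall>v\<in>mcarrier M. mact M (prook_one m) v = v) \<and>
     (\<forall>s\<in>planar_rook m. \<forall>t\<in>planar_rook m. \<forall>v\<in>mcarrier M.
        mact M (s \<circ>\<^sub>m t) v = mact M s (mact M t v))"

definition fin_dim :: "('k::field, 'v::ab_group_add) pmod \<Rightarrow> bool" where
  "fin_dim M \<longleftrightarrow> (\<exists>B. finite B \<and> module.span (mscale M) B = mcarrier M)"

definition mdim :: "('k::field, 'v::ab_group_add) pmod \<Rightarrow> nat" where
  "mdim M = vector_space.dim (mscale M) (mcarrier M)"

text \<open>For \<open>e\<close> an idempotent with \<open>j\<close> through strands this is the value on the \<open>j\<close>-th class.\<close>

definition chi :: "('k::field, 'v::ab_group_add) pmod \<Rightarrow> (nat \<rightharpoonup> nat) \<Rightarrow> nat" where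
  "chi M e = vector_space.dim (mscale M) (mact M e ` mcarrier M)"

definition is_submodule :: "nat \<Rightarrow> ('k::field, 'v::ab_group_add) pmod \<Rightarrow> 'v set \<Rightarrow> bool" where
  "is_submodule m M U \<longleftrightarrow> U \<subseteq> mcarrier M \<and> module.subspace (mscale M) U \<and>
     (\<forall>s\<in>planar_rook m. mact M s ` U \<subseteq> U)"

definition is_simple :: "nat \<Rightarrow> ('k::field, 'v::ab_group_add) pmod \<Rightarrow> bool" where
  "is_simple m M \<longleftrightarrow> is_module m M \<and> mcarrier M \<noteq> {0} \<and>
     (\<forall>U. is_submodule m M U \<longrightarrow> U = {0} \<or> U = mcarrier M)"

definition simple_with_apex ::
  "nat \<Rightarrow> nat \<Rightarrow> (nat \<rightharpoonup> nat) \<Rightarrow> ('k::field, 'v::ab_group_add) pmod \<Rightarrow> bool" where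
  "simple_with_apex m l e S \<longleftrightarrow> is_simple m S \<and> idempotent_in_class m l e \<and>
     mact S e ` mcarrier S \<noteq> {0} \<and>
     (\<forall>s\<in>planar_rook m. strands s < l \<longrightarrow> (\<forall>v\<in>mcarrier S. mact S s v = 0))"


section \<open>Composition series\<close>

text \<open>By the correspondence theorem, the quotient of \<open>U\<close> by \<open>W\<close> is simple iff \<open>W\<close> is a maximal
  proper submodule of \<open>U\<close>.\<close>

definition simple_factor ::
  "nat \<Rightarrow> ('k::field, 'v::ab_group_add) pmod \<Rightarrow> 'v set \<Rightarrow> 'v set \<Rightarrow> bool" where
  "simple_factor m M U W \<longleftrightarrow> is_submodule m M U \<and> is_submodule m M W \<and> W \<subset> U \<and>
     (\<forall>X. is_submodule m M X \<and> W \<subseteq> X \<and> X \<subseteq> U \<longrightarrow> X = W \<or> X = U)"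

text \<open>The quotient of \<open>U\<close> by \<open>W\<close> is isomorphic to \<open>S\<close>: there is a module homomorphism from \<open>U\<close>
  onto \<open>S\<close> with kernel \<open>W\<close>.\<close>

definition factor_iso ::
  "nat \<Rightarrow> ('k::field, 'v::ab_group_add) pmod \<Rightarrow> 'v set \<Rightarrow> 'v set \<Rightarrow>
     ('k, 'w::ab_group_add) pmod \<Rightarrow> bool" where
  "factor_iso m M U W S \<longleftrightarrow> (\<exists>f. lin_on (M\<lparr>mcarrier := U\<rparr>) (mscale S) f \<and>
     (\<forall>s\<in>planar_rook m. \<forall>v\<in>U. f (mact M s v) = mact S s (f v)) \<and>
     f ` U = mcarrier S \<and> {v\<in>U. f v = 0} = W)"

definition comp_series ::
  "nat \<Rightarrow> ('k::field, 'v::ab_group_add) pmod \<Rightarrow> (nat \<Rightarrow> 'v set) \<Rightarrow> nat \<Rightarrow> bool" where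
  "comp_series m M F r \<longleftrightarrow> F 0 = {0} \<and> F r = mcarrier M \<and>
     (\<forall>i<r. simple_factor m M (F (Suc i)) (F i))"

text \<open>In the next definitions \<open>THE\<close> refers to numbers that exist and are unique for
  finite-dimensional modules, by the theorems of Jordan--Hoelder and Krull--Schmidt.\<close>

definition comp_length :: "nat \<Rightarrow> ('k::field, 'v::ab_group_add) pmod \<Rightarrow> nat" where
  "comp_length m M = (THE r. \<exists>F. comp_series m M F r)"

definition comp_mult ::
  "nat \<Rightarrow> ('k::field, 'v::ab_group_add) pmod \<Rightarrow> ('k, 'w::ab_group_add) pmod \<Rightarrow> nat" where
  "comp_mult m M S = (THE c. \<exists>F r. comp_series m M F r \<and>
     c = card {i. i < r \<and> factor_iso m M (F (Suc i)) (F i) S})"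


section \<open>Indecomposable summands\<close>

definition indecomposable :: "nat \<Rightarrow> ('k::field, 'v::ab_group_add) pmod \<Rightarrow> bool" where
  "indecomposable m M \<longleftrightarrow> mcarrier M \<noteq> {0} \<and>
     (\<forall>U W. is_submodule m M U \<and> is_submodule m M W \<and> U \<inter> W = {0} \<and>
        {u + w | u w. u \<in> U \<and> w \<in> W} = mcarrier M \<longrightarrow> U = {0} \<or> W = {0})"

definition indec_decomp ::
  "nat \<Rightarrow> ('k::field, 'v::ab_group_add) pmod \<Rightarrow> (nat \<Rightarrow> 'v set) \<Rightarrow> nat \<Rightarrow> bool" where
  "indec_decomp m M D r \<longleftrightarrow>
     (\<forall>i<r. is_submodule m M (D i) \<and> indecomposable m (M\<lparr>mcarrier := D i\<rparr>)) \<and>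
     {\<Sum>i<r. x i | x. \<forall>i<r. x i \<in> D i} = mcarrier M \<and>
     (\<forall>x. (\<forall>i<r. x i \<in> D i) \<and> (\<Sum>i<r. x i) = 0 \<longrightarrow> (\<forall>i<r. x i = 0))"

definition num_indec :: "nat \<Rightarrow> ('k::field, 'v::ab_group_add) pmod \<Rightarrow> nat" where
  "num_indec m M = (THE r. \<exists>D. indec_decomp m M D r)"


section \<open>Tensor powers\<close>

text \<open>Over a field, the tensor power embeds canonically into the multilinear forms on the dual
  space, by evaluation of functionals: it is the span of the forms
  \<open>(f\<^sub>1, \<dots>, f\<^sub>n) \<mapsto> f\<^sub>1(v\<^sub>1) \<cdots> f\<^sub>n(v\<^sub>n)\<close>, which are the pure tensors.  A form is a function on lists
  of functions that is zero on lists which do not consist of functionals.\<close>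

definition functionals :: "('k::field, 'v::ab_group_add) pmod \<Rightarrow> ('v \<Rightarrow> 'k) set" where
  "functionals M = {f. lin_on M (*) f}"

definition pure_tensor ::
  "('k::field, 'v::ab_group_add) pmod \<Rightarrow> 'v list \<Rightarrow> ('v \<Rightarrow> 'k) list \<Rightarrow> 'k" where
  "pure_tensor M vs = (\<lambda>fs. if length fs = length vs \<and> set fs \<subseteq> functionals M
     then \<Prod>i<length vs. (fs ! i) (vs ! i) else 0)"

definition tensor_scale :: "'k::field \<Rightarrow> ('a \<Rightarrow> 'k) \<Rightarrow> 'a \<Rightarrow> 'k" where
  "tensor_scale c t = (\<lambda>x. c * t x)"

definition tensor_power ::
  "('k::field, 'v::ab_group_add) pmod \<Rightarrow> nat \<Rightarrow> ('k, ('v \<Rightarrow> 'k) list \<Rightarrow> 'k) pmod" where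
  "tensor_power M n = \<lparr>
     mcarrier = module.span tensor_scale {pure_tensor M vs | vs. length vs = n \<and> set vs \<subseteq> mcarrier M},
     mscale = tensor_scale,
     mact = (\<lambda>s t fs. if set fs \<subseteq> functionals M then t (map (\<lambda>f. f \<circ> mact M s) fs) else 0) \<rparr>"

text \<open>The action on tensor powers is the diagonal one.\<close>

lemma functional_comp_act:
  assumes "is_module m M" "s \<in> planar_rook m" "f \<in> functionals M"
  shows "f \<circ> mact M s \<in> functionals M"
  using assms unfolding is_module_def functionals_def lin_on_def
  by (auto simp: image_subset_iff)

lemma tensor_power_act_pure:
  assumes "is_module m M" "s \<in> planar_rook m"
  shows "mact (tensor_power M n) s (pure_tensor M vs) = pure_tensor M (map (mact M s) vs)"
  using functional_comp_act[OF assms]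
  by (auto simp: tensor_power_def pure_tensor_def fun_eq_iff intro!: prod.cong)

lemma pure_tensor_add:
  assumes "i < length vs" "u \<in> mcarrier M" "v \<in> mcarrier M"
  shows "pure_tensor M (vs[i := u + v]) = pure_tensor M (vs[i := u]) + pure_tensor M (vs[i := v])"
proof
  fix fs
  show "pure_tensor M (vs[i := u + v]) fs
      = (pure_tensor M (vs[i := u]) + pure_tensor M (vs[i := v])) fs"
  proof (cases "length fs = length vs \<and> set fs \<subseteq> functionals M")
    case True
    have split: "(\<Prod>j<length vs. (fs ! j) (vs[i := w] ! j))
        = (fs ! i) w * (\<Prod>j\<in>{..<length vs} - {i}. (fs ! j) (vs ! j))" for w
      using assms(1) by (subst prod.remove[of _ i]) (auto intro!: prod.cong)
    have "fs ! i \<in> functionals M"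
      using True assms(1) by auto
    then show ?thesis
      using True assms by (auto simp: pure_tensor_def split functionals_def lin_on_def distrib_right)
  qed (auto simp: pure_tensor_def)
qed

lemma pure_tensor_scale:
  assumes "i < length vs" "v \<in> mcarrier M"
  shows "pure_tensor M (vs[i := mscale M c v]) = tensor_scale c (pure_tensor M (vs[i := v]))"
proof
  fix fs
  show "pure_tensor M (vs[i := mscale M c v]) fs = tensor_scale c (pure_tensor M (vs[i := v])) fs"
  proof (cases "length fs = length vs \<and> set fs \<subseteq> functionals M")
    case True
    have split: "(\<Prod>j<length vs. (fs ! j) (vs[i := w] ! j))
        = (fs ! i) w * (\<Prod>j\<in>{..<length vs} - {i}. (fs ! j) (vs ! j))" for w
      using assms(1) by (subst prod.remove[of _ i]) (auto intro!: prod.cong)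
    have "fs ! i \<in> functionals M"
      using True assms(1) by auto
    then show ?thesis
      using True assms
      by (auto simp: pure_tensor_def split functionals_def lin_on_def tensor_scale_def)
  qed (auto simp: pure_tensor_def tensor_scale_def)
qed

end

theory Submission
  imports Defs "HOL-Library.Infinite_Set"
begin

text \<open>Moebius inversion turns the commuting partial identities on subsets \<open>B\<close> of \<open>{1..m}\<close> into
  orthogonal idempotents with sum 1, so that every module is the direct sum of its weight spaces
  \<open>weight B\<close>.  A diagram maps \<open>weight B\<close> to \<open>0\<close> unless it is defined on all of \<open>B\<close>, and then it maps
  \<open>weight B\<close> isomorphically onto the weight space of the image of \<open>B\<close>; the only order-preserving bijection
  of \<open>B\<close> is the identity.  Hence a submodule is determined by one weight space for each cardinality
  \<open>l\<close>, where it can be an arbitrary subspace.  In any characteristic, modules are therefore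
  semisimple, and the multiplicity of the simple module with apex \<open>l\<close> is the dimension \<open>d l\<close> of such
  a weight space.  The idempotent with \<open>j\<close> through strands projects onto the weight spaces of the
  subsets of a set with \<open>j\<close> elements, so \<open>\<chi>(j)\<close> is the sum of \<open>(j choose l) * d l\<close>; binomial inversion
  gives (a), since \<open>\<chi>\<close> is multiplicative on tensor products.  For (b), \<open>\<chi>(j) = (j choose i)\<close>, and the
  dominant term belongs to \<open>j = m\<close>.\<close>

section \<open>Linear algebra and binomial inversion\<close>

text \<open>The Moebius inversion has only the coefficients 1 and -1, and the corner of the monoid
  algebra at each resulting idempotent is the field itself; this is why no characteristic is
  exceptional. Quotients are never formed: a factor \<open>U / W\<close> is studied through the
  intersections of \<open>U\<close> and \<open>W\<close> with the chosen weight spaces. Their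
  dimensions add up to a function \<open>len\<close> on submodules that is additive on direct sums
  and strictly monotone. Lengths and numbers of summands come out as values of \<open>len\<close>,
  and this also supplies the uniqueness behind each \<open>THE\<close>. The delicate point is to
  identify a factor with an abstract simple module, which lives in another type: there the
  homomorphism has to be built as a graph.\<close>

context vector_space
begin

lemma finite_basis_exists:
  assumes "subspace P" "P \<subseteq> span S" "finite S"
  obtains B where "finite B" "independent B" "span B = P" "card B = dim P"
proof -
  obtain B where B: "B \<subseteq> P" "independent B" "P \<subseteq> span B" "card B = dim P"
    by (rule basis_exists)
  have "finite B"
    using independent_span_bound[OF assms(3) B(2)] B(1) assms(2) by blast
  moreover have "span B = P"
    using B(1,3) assms(1) by (simp add: span_minimal subset_antisym)
  ultimately show ?thesis using that B by blast
qed

text \<open>A vanishing combination splits at \<open>B\<close> into two sums that are negatives of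
  each other, so both lie in the intersection of the spans, which is zero.\<close>

lemma independent_Un:
  assumes "independent B" "independent C" "span B \<inter> span C = {0}"
  shows "independent (B \<union> C)"
proof
  assume "dependent (B \<union> C)"
  then obtain t u where t: "finite t" "t \<subseteq> B \<union> C" "(\<Sum>v\<in>t. scale (u v) v) = 0"
    and nz: "\<exists>v\<in>t. u v \<noteq> 0"
    unfolding dependent_explicit by blast
  let ?b = "\<Sum>v\<in>t \<inter> B. scale (u v) v" and ?c = "\<Sum>v\<in>t - B. scale (u v) v"
  have sum: "?b + ?c = 0"
    using t(1,3) by (subst sum.Int_Diff[of t _ B, symmetric]) auto
  have "?b \<in> span B" by (intro span_sum span_scale span_base) auto
  moreover have c: "?c \<in> span C"
    using t(2) by (intro span_sum span_scale span_base) auto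
  have "?b = - ?c" using sum by (simp add: eq_neg_iff_add_eq_0)
  then have "?b \<in> span C" using span_neg[OF c] by simp
  ultimately have b0: "?b = 0" using assms(3) by blast
  then have c0: "?c = 0" using sum by simp
  have "u v = 0" if "v \<in> t" for v
  proof (cases "v \<in> B")
    case True
    then show ?thesis
      using independentD[OF assms(1) _ _ b0] t(1) that by blast
  next
    case False
    then show ?thesis
      using independentD[OF assms(2) _ _ c0] t(1,2) that by blast
  qed
  then show False using nz by blast
qed

text \<open>The finite set \<open>S\<close> guarantees finite bases; for an infinite basis
  \<open>card\<close>, and hence \<open>dim\<close>, would be 0 and additivity could fail.\<close>

lemma dim_direct_sum:
  assumes "subspace P" "subspace Q" "P \<inter> Q = {0}"
    and "R = {p + q | p q. p \<in> P \<and> q \<in> Q}" "R \<subseteq> span S" "finite S"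
  shows "dim R = dim P + dim Q"
proof -
  have PQ: "P \<subseteq> R" "Q \<subseteq> R"
    using assms(1,2,4) subspace_0 by (force, force)
  obtain B where B: "finite B" "independent B" "span B = P" "card B = dim P"
    using finite_basis_exists assms(1,5,6) PQ(1) by (metis subset_trans)
  obtain C where C: "finite C" "independent C" "span C = Q" "card C = dim Q"
    using finite_basis_exists assms(2,5,6) PQ(2) by (metis subset_trans)
  have "independent (B \<union> C)"
    using B C assms(3) independent_Un by auto
  moreover have "span (B \<union> C) = R"
    using assms(4) B(3) C(3) by (simp add: span_Un)
  moreover have "card (B \<union> C) = card B + card C"
  proof (rule card_Un_disjoint)
    have "0 \<notin> B" using B(2) dependent_zero by blast
    moreover have "B \<inter> C \<subseteq> {0}"
      unfolding assms(3)[symmetric] B(3)[symmetric] C(3)[symmetric] using span_superset by blast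
    ultimately show "B \<inter> C = {}" by blast
  qed (use B C in auto)
  ultimately show ?thesis
    using B(4) C(4) dim_span_eq_card_independent by metis
qed

lemma dim_zero [simp]: "dim {0} = 0"
  using dim_span[of "{}"] dim_eq_card_independent[OF independent_empty] by simp

lemma dim_line: "u \<noteq> 0 \<Longrightarrow> dim (span {u}) = 1"
  using dim_eq_card_independent[of "{u}"] by simp

text \<open>The action of a diagram is linear only on the carrier, while \<open>linear\<close>
  speaks of the whole type. Prescribing the values on a basis of \<open>P\<close> gives a global
  linear map that agrees with \<open>f\<close> on \<open>P\<close>.\<close>

lemma linear_extension:
  assumes "subspace P"
    and "\<And>u v. u \<in> P \<Longrightarrow> v \<in> P \<Longrightarrow> f (u + v) = f u + f v"
    and "\<And>c v. v \<in> P \<Longrightarrow> f (scale c v) = scale' c (f v)"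
    and "vector_space scale'"
  obtains g where "Vector_Spaces.linear scale scale' g" "\<And>v. v \<in> P \<Longrightarrow> g v = f v"
proof -
  interpret W: vector_space scale' by fact
  interpret pair: vector_space_pair scale scale' ..
  obtain B where B: "B \<subseteq> P" "independent B" "P \<subseteq> span B"
    using basis_exists by metis
  obtain g where g: "Vector_Spaces.linear scale scale' g" "\<forall>x\<in>B. g x = f x"
    using pair.linear_independent_extend[OF B(2)] by blast
  interpret g: Vector_Spaces.linear scale scale' g by fact
  have f0: "f 0 = 0"
    using assms(3)[of 0 0] subspace_0[OF assms(1)] by simp
  have "v \<in> P \<and> g v = f v" if "v \<in> span B" for v
    using that
  proof (induction rule: span_induct_alt)
    case base
    then show ?case using f0 subspace_0[OF assms(1)] g.zero by simp
  next
    case (step c x y)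
    then have "x \<in> P" "g x = f x" using B g by auto
    with step show ?case
      using assms by (auto simp: g.add g.scale subspace_add subspace_scale)
  qed
  then show ?thesis using that g(1) B(3) by blast
qed

lemma dim_bij:
  assumes "subspace P" "bij_betw f P Q"
    and "\<And>u v. u \<in> P \<Longrightarrow> v \<in> P \<Longrightarrow> f (u + v) = f u + f v"
    and "\<And>c v. v \<in> P \<Longrightarrow> f (scale c v) = scale c (f v)"
  shows "dim Q = dim P"
proof -
  interpret pair: vector_space_pair scale scale ..
  obtain g where g: "Vector_Spaces.linear scale scale g" "\<And>v. v \<in> P \<Longrightarrow> g v = f v"
    using linear_extension[OF assms(1,3,4) vector_space_axioms] by blast
  interpret g: Vector_Spaces.linear scale scale g by fact
  have inj: "inj_on g P" and im: "g ` P = Q"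
    using assms(2) g(2) by (auto simp: bij_betw_def inj_on_def image_iff)
  obtain B where B: "B \<subseteq> P" "independent B" "P \<subseteq> span B" "card B = dim P"
    using basis_exists by metis
  have sp: "span B = P"
    using B(1,3) assms(1) by (simp add: span_minimal subset_antisym)
  have "independent (g ` B)"
    using B(2) inj sp by (intro g.independent_injective_image) auto
  moreover have "span (g ` B) = Q"
    using g.span_image sp im by metis
  moreover have "card (g ` B) = card B"
    using card_image inj B(1) inj_on_subset by metis
  ultimately show ?thesis
    using B(4) dim_span_eq_card_independent by metis
qed

text \<open>A basis of \<open>Q\<close> is enlarged by \<open>u\<close> and then to a basis
  \<open>B\<close> of \<open>P\<close>; the hyperplane is spanned by \<open>B - {u}\<close>. It
  serves to split off the line of \<open>u\<close> while a given smaller space stays in the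
  complement.\<close>

lemma hyperplane_exists:
  assumes "subspace P" "subspace Q" "Q \<subseteq> P" "u \<in> P" "u \<notin> Q"
  obtains H where "subspace H" "Q \<subseteq> H" "H \<subseteq> P" "u \<notin> H"
    "\<And>p. p \<in> P \<Longrightarrow> \<exists>c. p - scale c u \<in> H"
proof -
  obtain C where C: "C \<subseteq> Q" "independent C" "Q \<subseteq> span C"
    using basis_exists by metis
  have "span C \<subseteq> Q" using C(1) assms(2) span_minimal by blast
  then have uC: "u \<notin> span C" using assms(5) by blast
  have "independent (insert u C)"
    using C(2) uC independent_insertI by blast
  moreover have "insert u C \<subseteq> P" using assms C by blast
  ultimately obtain B where B: "insert u C \<subseteq> B" "B \<subseteq> P" "independent B" "P \<subseteq> span B"
    using maximal_independent_subset_extend by metis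
  show ?thesis
  proof
    show "Q \<subseteq> span (B - {u})"
      using C(3) B(1) uC span_base[of u C] span_mono[of C "B - {u}"] by blast
    show "span (B - {u}) \<subseteq> P" using B(2) assms(1) by (intro span_minimal) auto
    show "u \<notin> span (B - {u})" using B(1,3) unfolding dependent_def by blast
    show "\<exists>c. p - scale c u \<in> span (B - {u})" if "p \<in> P" for p
      using that B(1,4) span_breakdown[of u B p] by blast
  qed simp
qed

end

text \<open>Trinomial revision turns the coefficient of \<open>d i\<close> into
  \<open>l choose i\<close> times the alternating sum of row \<open>l - i\<close> of Pascal's
  triangle, which vanishes unless \<open>i = l\<close>.\<close>

lemma binomial_inversion:
  fixes a d :: "nat \<Rightarrow> int"
  assumes "\<And>j. j \<le> l \<Longrightarrow> a j = (\<Sum>i\<le>j. int (j choose i) * d i)"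
  shows "(\<Sum>j\<le>l. (-1) ^ (l - j) * int (l choose j) * a j) = d l"
proof -
  have coeff: "(\<Sum>j\<in>{i..l}. (-1) ^ (l - j) * int (l choose j) * int (j choose i))
      = (if i = l then 1 else 0)" if "i \<le> l" for i
  proof -
    have "(\<Sum>j\<in>{i..l}. (-1) ^ (l - j) * int (l choose j) * int (j choose i))
      = (\<Sum>j\<in>{i..l}. int (l choose i) * ((-1) ^ (l - j) * int ((l - i) choose (l - j))))"
    proof (rule sum.cong[OF refl])
      fix j assume j: "j \<in> {i..l}"
      have "(l choose j) * (j choose i) = (l choose i) * ((l - i) choose (j - i))"
        using j choose_mult by simp
      also have "(l - i) choose (j - i) = (l - i) choose (l - j)"
        using j by (subst binomial_symmetric) auto
      finally show "(-1) ^ (l - j) * int (l choose j) * int (j choose i)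
        = int (l choose i) * ((-1) ^ (l - j) * int ((l - i) choose (l - j)))"
        by (metis (no_types, lifting) mult.assoc mult.left_commute of_nat_mult)
    qed
    also have "\<dots> = int (l choose i) * (\<Sum>k\<le>l - i. (-1) ^ k * int ((l - i) choose k))"
      unfolding sum_distrib_left
      by (rule sum.reindex_bij_witness[of _ "\<lambda>k. l - k" "\<lambda>j. l - j"]) (use that in auto)
    also have "\<dots> = (if i = l then 1 else 0)"
      using choose_alternating_sum[of "l - i", where 'a = int] that by (cases "i = l") auto
    finally show ?thesis .
  qed
  have "(\<Sum>j\<le>l. (-1) ^ (l - j) * int (l choose j) * a j)
      = (\<Sum>j\<le>l. \<Sum>i\<le>j. (-1) ^ (l - j) * int (l choose j) * int (j choose i) * d i)"
    using assms by (intro sum.cong) (auto simp: sum_distrib_left mult.assoc)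
  also have "\<dots> = (\<Sum>i\<le>l. \<Sum>j\<in>{i..l}. (-1) ^ (l - j) * int (l choose j) * int (j choose i) * d i)"
    by (subst sum.Sigma sum.Sigma, simp, simp)+
      (rule sum.reindex_bij_witness[of _ "\<lambda>(i, j). (j, i)" "\<lambda>(j, i). (i, j)"]; auto)
  also have "\<dots> = (\<Sum>i\<le>l. (if i = l then 1 else 0) * d i)"
    using coeff by (intro sum.cong) (auto simp: sum_distrib_right[symmetric])
  also have "\<dots> = d l"
    by (simp add: if_distrib[of "\<lambda>x. x * _"] cong: if_cong)
  finally show ?thesis .
qed

section \<open>Partial identities and order isomorphisms\<close>

definition pid :: "nat set \<Rightarrow> nat \<rightharpoonup> nat" where
  "pid A = Some |` A"

lemma comp_pid: "t \<circ>\<^sub>m pid A = t |` A"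
  by (auto simp: pid_def map_comp_def restrict_map_def fun_eq_iff)

lemma pid_comp: "pid B \<circ>\<^sub>m t = t |` {x. \<exists>b\<in>B. t x = Some b}"
  by (auto simp: pid_def map_comp_def restrict_map_def fun_eq_iff split: option.splits)

lemma pid_restrict: "pid A |` B = pid (A \<inter> B)"
  by (simp add: pid_def)

lemma dom_pid [simp]: "dom (pid A) = A"
  by (auto simp: pid_def)

lemma ran_pid [simp]: "ran (pid A) = A"
  by (auto simp: pid_def ran_def restrict_map_def)

lemma prook_one_eq: "prook_one m = pid {1..m}"
  by (auto simp: prook_one_def pid_def restrict_map_def)

lemma pid_planar_rook: "A \<subseteq> {1..m} \<Longrightarrow> pid A \<in> planar_rook m"
  by (auto simp: planar_rook_def pid_def restrict_map_def ran_def inj_on_def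
      split: if_splits)

lemma planar_rook_comp:
  assumes "s \<in> planar_rook m" "t \<in> planar_rook m"
  shows "s \<circ>\<^sub>m t \<in> planar_rook m"
proof -
  have s: "s x = Some a \<Longrightarrow> x \<in> {1..m} \<and> a \<in> {1..m}"
    and t: "t x = Some a \<Longrightarrow> x \<in> {1..m} \<and> a \<in> {1..m}" for x a
    using assms unfolding planar_rook_def by (blast intro: ranI)+
  have sm: "s x = Some a \<Longrightarrow> s y = Some b \<Longrightarrow> x \<le> y \<Longrightarrow> a \<le> b"
    and tm: "t x = Some a \<Longrightarrow> t y = Some b \<Longrightarrow> x \<le> y \<Longrightarrow> a \<le> b" for x y a b
    using assms unfolding planar_rook_def by blast+
  have si: "s x = Some a \<Longrightarrow> s y = Some a \<Longrightarrow> x = y"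
    and ti: "t x = Some a \<Longrightarrow> t y = Some a \<Longrightarrow> x = y" for x y a
    using assms unfolding planar_rook_def by (auto simp: inj_on_def dom_def)
  have st: "(s \<circ>\<^sub>m t) x = Some a \<longleftrightarrow> (\<exists>y. t x = Some y \<and> s y = Some a)" for x a
    by (auto simp: map_comp_def split: option.splits)
  show ?thesis
    unfolding planar_rook_def
  proof (safe, goal_cases)
    case (1 x y) then show ?case using t st by blast
  next
    case (2 x) then show ?case using s st unfolding ran_def by blast
  next
    case 3
    show ?case
    proof (rule inj_onI)
      fix x y assume "x \<in> dom (s \<circ>\<^sub>m t)" and eq: "(s \<circ>\<^sub>m t) x = (s \<circ>\<^sub>m t) y"
      then obtain a where a: "(s \<circ>\<^sub>m t) x = Some a" by blast
      then obtain u v where "t x = Some u" "s u = Some a" "t y = Some v" "s v = Some a"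
        using st eq by metis
      then show "x = y" using si ti by blast
    qed
  next
    case 4 then show ?case using st sm tm by meson
  qed
qed

lemma planar_rook_restrict:
  "t \<in> planar_rook m \<Longrightarrow> A \<subseteq> {1..m} \<Longrightarrow> t |` A \<in> planar_rook m"
  using planar_rook_comp[OF _ pid_planar_rook] by (simp add: comp_pid)

text \<open>This is the triviality of the maximal subgroups. A monotone bijection of
  \<open>A\<close> maps the increasing enumeration of \<open>A\<close> to an increasing list with
  the same elements, which can only be the same list.\<close>

lemma planar_rook_restrict_self:
  assumes "t \<in> planar_rook m" "A \<subseteq> dom t" "ran (t |` A) = A"
  shows "t |` A = pid A"
proof -
  define f where "f x = the (t x)" for x
  have t: "t x = Some (f x)" if "x \<in> A" for x
    using that assms(2) by (auto simp: f_def)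
  have fin: "finite A"
    using assms(1,2) finite_subset[of A "{1..m}"] by (auto simp: planar_rook_def)
  have fA: "f ` A = A"
    using assms(3) t by (auto simp: ran_def restrict_map_def split: if_splits; force)
  have inj: "inj_on f A"
    using fin fA by (simp add: finite_surj_inj)
  let ?L = "sorted_list_of_set A"
  have "map f ?L = ?L"
  proof (rule sorted_distinct_set_unique)
    have mono: "f x \<le> f y" if "x \<in> A" "y \<in> A" "x \<le> y" for x y
      using assms(1) that t unfolding planar_rook_def by blast
    have "sorted_wrt (\<lambda>x y. f x \<le> f y) ?L"
      by (rule sorted_wrt_mono_rel[of _ "(\<le>)"]) (use fin mono in auto)
    then show "sorted (map f ?L)" by (simp add: sorted_map)
  qed (use fin fA inj in \<open>auto simp: distinct_map\<close>)
  then have "f x = x" if "x \<in> A" for x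
    using that fin map_eq_conv[of f ?L id] by auto
  then show ?thesis
    using t by (auto simp: pid_def restrict_map_def)
qed

text \<open>The diagrams join the vertices of equal rank in \<open>A\<close> and \<open>B\<close>,
  where ranks come from the increasing enumerations by \<open>{..<card A}\<close>.\<close>

lemma planar_rook_iso:
  assumes "A \<subseteq> {1..m}" "B \<subseteq> {1..m}" "card A = card B"
  obtains s t where "s \<in> planar_rook m" "t \<in> planar_rook m" "dom s = A" "dom t = B"
    "t \<circ>\<^sub>m s = pid A" "s \<circ>\<^sub>m t = pid B"
proof -
  have fin: "finite A" "finite B" using assms finite_subset by blast+
  obtain f where f: "bij_betw f {..<card A} A" "strict_mono_on {..<card A} f"
    by (rule ex_bij_betw_strict_mono_card[OF fin(1)])
  obtain g where g: "bij_betw g {..<card A} B" "strict_mono_on {..<card A} g"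
    unfolding assms(3) by (rule ex_bij_betw_strict_mono_card[OF fin(2)])
  \<comment> \<open>\<open>T h h'\<close> sends \<open>h i\<close> to \<open>h' i\<close>.
    Exchanging the two enumerations gives both \<open>s\<close> and \<open>t\<close>, so planarity
    and the composites are each proved only once.\<close>
  define T where "T h h' = (\<lambda>x::nat. if x \<in> h ` {..<card A}
    then Some (h' (the_inv_into {..<card A} h x)) else (None :: nat option))" for h h' :: "nat \<Rightarrow> nat"
  have T: "T h h' (h i) = Some (h' i)" if "inj_on h {..<card A}" "i < card A" for h h' i
    using that by (auto simp: T_def the_inv_into_f_f)
  have T': "\<exists>i<card A. x = h i \<and> a = h' i"
    if "T h h' x = Some a" "inj_on h {..<card A}" for h h' x a
    using that by (auto simp: T_def the_inv_into_f_f split: if_splits)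
  have dom: "dom (T h h') = h ` {..<card A}" for h h'
    by (auto simp: T_def split: if_splits)
  have planar: "T h h' \<in> planar_rook m"
    if h: "bij_betw h {..<card A} C" "strict_mono_on {..<card A} h" "C \<subseteq> {1..m}"
      and h': "bij_betw h' {..<card A} D" "strict_mono_on {..<card A} h'" "D \<subseteq> {1..m}"
    for h h' C D
  proof -
    note inj = bij_betw_imp_inj_on[OF h(1)] bij_betw_imp_inj_on[OF h'(1)]
    have "h ` {..<card A} \<subseteq> {1..m}" "h' ` {..<card A} \<subseteq> {1..m}"
      using h h' by (auto simp: bij_betw_def)
    moreover have "h' i \<le> h' j" if "h i \<le> h j" "i < card A" "j < card A" for i j
      using that h(2) h'(2) by (metis lessThan_iff linorder_not_less nless_le
          strict_mono_on_def)
    moreover have "inj_on (T h h') (h ` {..<card A})"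
      using inj by (auto simp: inj_on_def T)
    moreover have "ran (T h h') \<subseteq> {1..m}"
      using T'[OF _ inj(1)] calculation(2) unfolding ran_def by fastforce
    moreover have "a \<le> b" if "T h h' x = Some a \<and> T h h' y = Some b \<and> x \<le> y" for x y a b
      using T'[of h h' x a] T'[of h h' y b] inj(1) calculation(3) that by blast
    ultimately show ?thesis
      unfolding planar_rook_def dom mem_Collect_eq by (intro conjI allI impI)
  qed
  have comp: "T h' h \<circ>\<^sub>m T h h' = pid C"
    if h: "bij_betw h {..<card A} C" and h': "bij_betw h' {..<card A} D" for h h' C D
  proof
    fix x
    show "(T h' h \<circ>\<^sub>m T h h') x = pid C x"
    proof (cases "x \<in> C")
      case True
      then obtain i where "i < card A" "x = h i" using h by (auto simp: bij_betw_def)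
      then show ?thesis using True T bij_betw_imp_inj_on[OF h] bij_betw_imp_inj_on[OF h']
        by (simp add: pid_def)
    next
      case False
      then have "x \<notin> h ` {..<card A}" using h by (auto simp: bij_betw_def)
      then show ?thesis using False by (simp add: pid_def T_def)
    qed
  qed
  show ?thesis
    using that[OF planar[OF f assms(1) g assms(2)] planar[OF g assms(2) f assms(1)]]
      comp[OF f(1) g(1)] comp[OF g(1) f(1)] f(1) g(1)
    by (simp add: dom bij_betw_def)
qed

text \<open>If \<open>e x = Some a\<close>, idempotency gives \<open>e a = Some a\<close> as well,
  and injectivity forces \<open>a = x\<close>. So an arbitrary choice of idempotents amounts to a
  choice of one subset per cardinality.\<close>

lemma idempotent_in_class_pid:
  assumes "idempotent_in_class m j e"
  shows "e = pid (dom e)" "dom e \<subseteq> {1..m}" "card (dom e) = j"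
proof -
  have e: "e \<in> planar_rook m" "e \<circ>\<^sub>m e = e" "strands e = j"
    using assms by (auto simp: idempotent_in_class_def)
  show "dom e \<subseteq> {1..m}" "card (dom e) = j"
    using e by (auto simp: planar_rook_def strands_def)
  have "a = x" if "e x = Some a" for x a
  proof -
    have "e a = Some a" using e(2) that by (metis map_comp_simps(2))
    then show ?thesis using e(1) that by (auto simp: planar_rook_def inj_on_def dom_def)
  qed
  then show "e = pid (dom e)"
    by (fastforce simp: pid_def restrict_map_def fun_eq_iff)
qed

section \<open>Weight spaces\<close>

declare One_nat_def [simp del] \<comment> \<open>keeps \<open>{1..m}\<close> in the form in which it occurs in the hypotheses\<close>

lemma restrict_map_dom_self: "t |` dom t = t"
  by (auto simp: restrict_map_def fun_eq_iff domIff)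

text \<open>The Moebius inversion of the partial identities along inclusion, written recursively: \<open>eta M A\<close>
  is the primitive idempotent of the span of the partial identities that belongs to \<open>A\<close>.\<close>

function eta :: "('k, 'v::ab_group_add) pmod \<Rightarrow> nat set \<Rightarrow> 'v \<Rightarrow> 'v" where
  "eta M A v = (if finite A then mact M (pid A) v - (\<Sum>B\<in>{B. B \<subset> A}. eta M B v) else 0)"
  by pat_completeness auto
termination
  by (relation "measure (\<lambda>(M, A, v). card A)") (auto intro: psubset_card_mono)

declare eta.simps [simp del]

locale prook_module =
  fixes m :: nat and M :: "('k::field, 'v::ab_group_add) pmod"
  assumes is_module: "is_module m M"
begin

sublocale vs: vector_space "mscale M"
  using is_module by (simp add: is_module_def)

abbreviation "submodule \<equiv> is_submodule m M"

section \<open>Elementary properties of the action and of submodules\<close>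

lemma carrier_subspace: "vs.subspace (mcarrier M)"
  using is_module by (simp add: is_module_def)

lemma act_closed: "s \<in> planar_rook m \<Longrightarrow> v \<in> mcarrier M \<Longrightarrow> mact M s v \<in> mcarrier M"
  using is_module by (auto simp: is_module_def)

lemma act_add: "s \<in> planar_rook m \<Longrightarrow> u \<in> mcarrier M \<Longrightarrow> v \<in> mcarrier M \<Longrightarrow>
    mact M s (u + v) = mact M s u + mact M s v"
  using is_module by (auto simp: is_module_def lin_on_def)

lemma act_scale: "s \<in> planar_rook m \<Longrightarrow> v \<in> mcarrier M \<Longrightarrow>
    mact M s (mscale M c v) = mscale M c (mact M s v)"
  using is_module by (auto simp: is_module_def lin_on_def)

lemma act_comp: "s \<in> planar_rook m \<Longrightarrow> t \<in> planar_rook m \<Longrightarrow> v \<in> mcarrier M \<Longrightarrow>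
    mact M (s \<circ>\<^sub>m t) v = mact M s (mact M t v)"
  using is_module by (auto simp: is_module_def)

lemma act_one: "v \<in> mcarrier M \<Longrightarrow> mact M (pid {1..m}) v = v"
  using is_module by (auto simp: is_module_def prook_one_eq)

lemma act_zero [simp]: "s \<in> planar_rook m \<Longrightarrow> mact M s 0 = 0"
  using act_scale[of s 0 0] vs.subspace_0[OF carrier_subspace] by simp

lemma act_diff: "s \<in> planar_rook m \<Longrightarrow> u \<in> mcarrier M \<Longrightarrow> v \<in> mcarrier M \<Longrightarrow>
    mact M s (u - v) = mact M s u - mact M s v"
  using act_add[of s "u - v" v] vs.subspace_diff[OF carrier_subspace] by (simp add: eq_diff_eq)

lemma act_sum:
  "s \<in> planar_rook m \<Longrightarrow> (\<And>i. i \<in> I \<Longrightarrow> f i \<in> mcarrier M) \<Longrightarrow>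
    mact M s (\<Sum>i\<in>I. f i) = (\<Sum>i\<in>I. mact M s (f i))"
  by (induction I rule: infinite_finite_induct)
    (auto simp: act_add vs.subspace_sum[OF carrier_subspace])

lemma act_pid_comp: "A \<subseteq> {1..m} \<Longrightarrow> t \<in> planar_rook m \<Longrightarrow> v \<in> mcarrier M \<Longrightarrow>
    mact M t (mact M (pid A) v) = mact M (t |` A) v"
  using act_comp[OF _ pid_planar_rook] by (simp add: comp_pid)

lemma submodule_carrier: "submodule U \<Longrightarrow> v \<in> U \<Longrightarrow> v \<in> mcarrier M"
  and submodule_subspace: "submodule U \<Longrightarrow> vs.subspace U"
  and submodule_act: "submodule U \<Longrightarrow> s \<in> planar_rook m \<Longrightarrow> v \<in> U \<Longrightarrow> mact M s v \<in> U"
  by (auto simp: is_submodule_def)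

lemma submodule_zero: "submodule {0}"
  using vs.subspace_0[OF carrier_subspace] by (auto simp: is_submodule_def)

lemma submodule_whole: "submodule (mcarrier M)"
  using carrier_subspace act_closed by (auto simp: is_submodule_def)

lemma submodule_sum:
  assumes "submodule U" "submodule W"
  shows "submodule {u + w | u w. u \<in> U \<and> w \<in> W}"
  unfolding is_submodule_def
proof (intro conjI ballI)
  show "{u + w | u w. u \<in> U \<and> w \<in> W} \<subseteq> mcarrier M"
    using assms submodule_carrier vs.subspace_add[OF carrier_subspace] by blast
  show "vs.subspace {u + w | u w. u \<in> U \<and> w \<in> W}"
    using assms submodule_subspace vs.subspace_sums by blast
  show "mact M s ` {u + w | u w. u \<in> U \<and> w \<in> W} \<subseteq> {u + w | u w. u \<in> U \<and> w \<in> W}"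
    if "s \<in> planar_rook m" for s
  proof (rule image_subsetI)
    fix x assume "x \<in> {u + w | u w. u \<in> U \<and> w \<in> W}"
    then obtain u w where "x = u + w" "u \<in> U" "w \<in> W" by blast
    then show "mact M s x \<in> {u + w | u w. u \<in> U \<and> w \<in> W}"
      using that assms act_add[of s u w] submodule_carrier submodule_act by blast
  qed
qed

lemma is_submodule_restrict:
  "submodule U \<Longrightarrow> is_submodule m (M\<lparr>mcarrier := U\<rparr>) X \<longleftrightarrow> X \<subseteq> U \<and> submodule X"
  by (auto simp: is_submodule_def)

section \<open>Weight spaces and the effect of diagrams on them\<close>

definition weight :: "nat set \<Rightarrow> 'v set" where
  "weight A = {v \<in> mcarrier M. mact M (pid A) v = v \<and> (\<forall>B. B \<subset> A \<longrightarrow> mact M (pid B) v = 0)}"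

lemma weight_carrier: "v \<in> weight A \<Longrightarrow> v \<in> mcarrier M"
  by (simp add: weight_def)

lemma subspace_weight: "A \<subseteq> {1..m} \<Longrightarrow> vs.subspace (weight A)"
  using carrier_subspace
  by (auto simp: weight_def vs.subspace_def act_add act_scale pid_planar_rook)

text \<open>On this space \<open>pid B\<close> acts as \<open>pid (B \<inter> A)\<close>, and
  \<open>B \<inter> A\<close> is either \<open>A\<close> itself or a proper subset: the two cases in
  the definition of \<open>weight\<close>.\<close>

lemma act_pid_weight:
  assumes "v \<in> weight A" "A \<subseteq> {1..m}" "B \<subseteq> {1..m}"
  shows "mact M (pid B) v = (if A \<subseteq> B then v else 0)"
proof -
  have v: "v \<in> mcarrier M" "mact M (pid A) v = v"
    using assms(1) by (auto simp: weight_def)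
  have "mact M (pid B) v = mact M (pid B) (mact M (pid A) v)" using v by simp
  also have "\<dots> = mact M (pid (B \<inter> A)) v"
    using act_pid_comp[OF assms(2) pid_planar_rook[OF assms(3)] v(1)] by (simp only: pid_restrict)
  also have "\<dots> = (if A \<subseteq> B then v else 0)"
    using assms(1) by (auto simp: weight_def Int_absorb1 psubset_eq)
  finally show ?thesis .
qed

lemma act_weight_eq_0:
  assumes "v \<in> weight A" "A \<subseteq> {1..m}" "t \<in> planar_rook m" "\<not> A \<subseteq> dom t"
  shows "mact M t v = 0"
proof -
  have t: "dom t \<subseteq> {1..m}" using assms(3) by (simp add: planar_rook_def)
  have "mact M t v = mact M t (mact M (pid (dom t)) v)"
    using act_pid_comp[OF t assms(3) weight_carrier[OF assms(1)]] by (simp add: restrict_map_dom_self)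
  also have "\<dots> = 0" using act_pid_weight[OF assms(1,2) t] assms(3,4) by simp
  finally show ?thesis .
qed

text \<open>Applying \<open>pid B\<close> after \<open>t\<close> is the same as applying
  \<open>t\<close> after the partial identity on the preimage of \<open>B\<close>. The latter fixes
  a vector of weight \<open>A\<close> if that preimage contains \<open>A\<close>, and kills it
  otherwise.\<close>

lemma act_weight:
  assumes "v \<in> weight A" "A \<subseteq> {1..m}" "t \<in> planar_rook m" "A \<subseteq> dom t"
  shows "mact M t v \<in> weight (ran (t |` A))"
proof -
  have v: "v \<in> mcarrier M" using assms(1) weight_carrier by blast
  have tv: "mact M t v = mact M (t |` A) v"
    using act_pid_comp[of A t v] act_pid_weight[OF assms(1,2,2)] assms v by simp
  have pid: "mact M (pid B) (mact M (t |` A) v)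
      = (if A \<subseteq> {x. \<exists>b\<in>B. (t |` A) x = Some b} then mact M (t |` A) v else 0)"
    if "B \<subseteq> ran (t |` A)" for B
  proof -
    have B: "B \<subseteq> {1..m}"
      using that planar_rook_restrict[OF assms(3,2)] by (auto simp: planar_rook_def)
    define D where "D = {x. \<exists>b\<in>B. (t |` A) x = Some b}"
    have D: "D \<subseteq> {1..m}"
      using assms(2) by (auto simp: D_def restrict_map_def split: if_splits)
    have "mact M (pid B) (mact M (t |` A) v) = mact M ((t |` A) |` D) v"
      using act_comp[OF pid_planar_rook[OF B] planar_rook_restrict[OF assms(3,2)] v]
      by (simp only: pid_comp D_def)
    also have "\<dots> = mact M (t |` A) (mact M (pid D) v)"
      using act_pid_comp[OF D planar_rook_restrict[OF assms(3,2)] v] by simp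
    also have "\<dots> = (if A \<subseteq> D then mact M (t |` A) v else 0)"
      using act_pid_weight[OF assms(1,2) D] planar_rook_restrict[OF assms(3,2)] by simp
    finally show ?thesis by (simp add: D_def)
  qed
  have "A \<subseteq> {x. \<exists>b\<in>ran (t |` A). (t |` A) x = Some b}"
  proof
    fix x assume x: "x \<in> A"
    then obtain b where "t x = Some b" using assms(4) by blast
    then have "(t |` A) x = Some b" using x by simp
    then show "x \<in> {x. \<exists>b\<in>ran (t |` A). (t |` A) x = Some b}" by (auto intro: ranI)
  qed
  then have "mact M (pid (ran (t |` A))) (mact M (t |` A) v) = mact M (t |` A) v"
    using pid[OF subset_refl] by simp
  moreover have "mact M (pid B) (mact M (t |` A) v) = 0" if B: "B \<subset> ran (t |` A)" for B
  proof -
    obtain b where b: "b \<in> ran (t |` A)" "b \<notin> B" using B by blast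
    then obtain a where "a \<in> A" "t a = Some b"
      by (auto simp: ran_def restrict_map_def split: if_splits)
    then have "\<not> A \<subseteq> {x. \<exists>b\<in>B. (t |` A) x = Some b}" using b by auto
    then show ?thesis using pid[of B] B by auto
  qed
  ultimately show ?thesis
    using act_closed[OF planar_rook_restrict[OF assms(3,2)] v] by (simp add: weight_def tv)
qed

lemma finite_subset_atLeastAtMost: "A \<subseteq> {1..m} \<Longrightarrow> finite A"
  using finite_subset by blast

section \<open>The idempotents \<open>eta\<close> and the weight decomposition\<close>

lemma eta_eq:
  "A \<subseteq> {1..m} \<Longrightarrow> eta M A v = mact M (pid A) v - (\<Sum>B\<in>{B. B \<subset> A}. eta M B v)"
  using eta.simps[of M A v] finite_subset_atLeastAtMost by simp

lemma sum_eta_Pow: "A \<subseteq> {1..m} \<Longrightarrow> (\<Sum>B\<in>Pow A. eta M B v) = mact M (pid A) v"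
proof -
  assume A: "A \<subseteq> {1..m}"
  have "Pow A = insert A {B. B \<subset> A}" by auto
  moreover have "finite {B. B \<subset> A}"
    using finite_subset_atLeastAtMost[OF A] by (auto intro: finite_subset[of _ "Pow A"])
  ultimately show ?thesis using eta_eq[OF A, of v] by simp
qed

text \<open>By the recursion, \<open>eta M A\<close> is an integer combination of actions of partial
  identities, so it preserves every submodule. This allows submodules to be compared weight by
  weight.\<close>

lemma eta_submodule:
  assumes "submodule U" "v \<in> U" "A \<subseteq> {1..m}"
  shows "eta M A v \<in> U"
proof -
  have "finite A" using assms(3) finite_subset_atLeastAtMost by blast
  then show ?thesis using assms(3)
  proof (induction A rule: finite_psubset_induct)
    case (psubset A)
    then have "(\<Sum>B\<in>{B. B \<subset> A}. eta M B v) \<in> U"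
      by (intro vs.subspace_sum[OF submodule_subspace[OF assms(1)]]) auto
    then show ?case
      using eta_eq[OF psubset.prems] submodule_act[OF assms(1) pid_planar_rook assms(2)] psubset.prems
        vs.subspace_diff[OF submodule_subspace[OF assms(1)]] by simp
  qed
qed

lemma eta_carrier: "v \<in> mcarrier M \<Longrightarrow> A \<subseteq> {1..m} \<Longrightarrow> eta M A v \<in> mcarrier M"
  using eta_submodule[OF submodule_whole] .

lemma eta_add:
  assumes "u \<in> mcarrier M" "v \<in> mcarrier M" "A \<subseteq> {1..m}"
  shows "eta M A (u + v) = eta M A u + eta M A v"
proof -
  have "finite A" using assms(3) finite_subset_atLeastAtMost by blast
  then show ?thesis using assms(3)
  proof (induction A rule: finite_psubset_induct)
    case (psubset A)
    then have "(\<Sum>B\<in>{B. B \<subset> A}. eta M B (u + v)) = (\<Sum>B\<in>{B. B \<subset> A}. eta M B u + eta M B v)"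
      by (intro sum.cong) auto
    then show ?case
      using psubset.prems assms by (simp add: eta_eq act_add pid_planar_rook sum.distrib)
  qed
qed

lemma eta_scale:
  assumes "v \<in> mcarrier M" "A \<subseteq> {1..m}"
  shows "eta M A (mscale M c v) = mscale M c (eta M A v)"
proof -
  have "finite A" using assms(2) finite_subset_atLeastAtMost by blast
  then show ?thesis using assms(2)
  proof (induction A rule: finite_psubset_induct)
    case (psubset A)
    then have "(\<Sum>B\<in>{B. B \<subset> A}. eta M B (mscale M c v)) = (\<Sum>B\<in>{B. B \<subset> A}. mscale M c (eta M B v))"
      by (intro sum.cong) auto
    then show ?case
      using psubset.prems assms
      by (simp add: eta_eq act_scale pid_planar_rook vs.scale_sum_right vs.scale_right_diff_distrib)
  qed
qed

lemma eta_zero: "A \<subseteq> {1..m} \<Longrightarrow> eta M A 0 = 0"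
  using eta_scale[of 0 A 0] vs.subspace_0[OF carrier_subspace] by simp

text \<open>On a vector of weight \<open>D\<close>, \<open>pid A\<close> acts as 1 when
  \<open>D \<subseteq> A\<close>; for \<open>D \<subset> A\<close> this is cancelled by the single
  surviving term \<open>B = D\<close> of the recursion.\<close>

lemma eta_of_weight:
  assumes "v \<in> weight D" "D \<subseteq> {1..m}" "A \<subseteq> {1..m}"
  shows "eta M A v = (if A = D then v else 0)"
proof -
  have "finite A" using assms(3) finite_subset_atLeastAtMost by blast
  then show ?thesis using assms(3)
  proof (induction A rule: finite_psubset_induct)
    case (psubset A)
    have fin: "finite {B. B \<subset> A}"
      using psubset.hyps by (auto intro: finite_subset[of _ "Pow A"])
    have "(\<Sum>B\<in>{B. B \<subset> A}. eta M B v) = (\<Sum>B\<in>{B. B \<subset> A}. if B = D then v else 0)"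
      using psubset by (intro sum.cong) auto
    also have "\<dots> = (if D \<subset> A then v else 0)" using fin by simp
    finally show ?case
      using eta_eq[OF psubset.prems] act_pid_weight[OF assms(1,2) psubset.prems] by auto
  qed
qed

text \<open>Composition with \<open>pid D\<close> turns the sum of \<open>eta M B\<close> over
  \<open>B \<subseteq> A\<close> into the sum over \<open>B \<subseteq> D \<inter> A\<close>. By
  induction the proper subsets of \<open>A\<close> contribute the same terms on both sides, which
  leaves the summand for \<open>A\<close>.\<close>

lemma act_pid_eta:
  assumes "v \<in> mcarrier M" "A \<subseteq> {1..m}" "D \<subseteq> {1..m}"
  shows "mact M (pid D) (eta M A v) = (if A \<subseteq> D then eta M A v else 0)"
proof -
  have "finite A" using assms(2) finite_subset_atLeastAtMost by blast
  then show ?thesis using assms(2)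
  proof (induction A rule: finite_psubset_induct)
    case (psubset A)
    have fin: "finite {B. B \<subset> A}"
      using psubset.hyps by (auto intro: finite_subset[of _ "Pow A"])
    have sub: "B \<subseteq> {1..m}" if "B \<subset> A" for B using that psubset.prems by blast
    have "mact M (pid D) (eta M A v)
        = mact M (pid D) (mact M (pid A) v) - (\<Sum>B\<in>{B. B \<subset> A}. mact M (pid D) (eta M B v))"
    proof -
      have c: "eta M B v \<in> mcarrier M" if "B \<in> {B. B \<subset> A}" for B
        using that by (intro eta_carrier assms(1) sub) simp
      have s: "(\<Sum>B\<in>{B. B \<subset> A}. mact M (pid D) (eta M B v))
          = mact M (pid D) (\<Sum>B\<in>{B. B \<subset> A}. eta M B v)"
        by (intro act_sum[symmetric] pid_planar_rook assms(3) c)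
      show ?thesis
        unfolding eta_eq[OF psubset.prems] s
        by (intro act_diff pid_planar_rook assms(3) act_closed psubset.prems assms(1)
            vs.subspace_sum[OF carrier_subspace c])
    qed
    also have "mact M (pid D) (mact M (pid A) v) = (\<Sum>B\<in>Pow (D \<inter> A). eta M B v)"
      using assms psubset.prems
      by (subst sum_eta_Pow) (auto simp: act_pid_comp pid_planar_rook pid_restrict)
    also have "(\<Sum>B\<in>{B. B \<subset> A}. mact M (pid D) (eta M B v))
        = (\<Sum>B\<in>{B. B \<subset> A}. if B \<subseteq> D then eta M B v else 0)"
      using psubset sub by (intro sum.cong) auto
    also have "\<dots> = (\<Sum>B\<in>{B. B \<subset> A \<and> B \<subseteq> D}. eta M B v)"
      using fin by (simp add: sum.inter_filter[symmetric])
    also have "(\<Sum>B\<in>Pow (D \<inter> A). eta M B v) - \<dots> = (if A \<subseteq> D then eta M A v else 0)"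
    proof (cases "A \<subseteq> D")
      case True
      have "Pow (D \<inter> A) = insert A {B. B \<subset> A \<and> B \<subseteq> D}" using True by auto
      then show ?thesis using True fin by simp
    next
      case False
      then have "Pow (D \<inter> A) = {B. B \<subset> A \<and> B \<subseteq> D}" by auto
      then show ?thesis using False by simp
    qed
    finally show ?case .
  qed
qed

text \<open>Weight spaces are defined by equations, so that membership can be tested on the action
  alone. Together with \<open>eta_of_weight\<close> this identifies them as the images of the
  idempotents.\<close>

lemma eta_weight:
  assumes "v \<in> mcarrier M" "A \<subseteq> {1..m}"
  shows "eta M A v \<in> weight A"
  unfolding weight_def using act_pid_eta[OF assms] assms eta_carrier by auto

lemma sum_eta: "v \<in> mcarrier M \<Longrightarrow> (\<Sum>B\<in>Pow {1..m}. eta M B v) = v"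
  by (simp add: sum_eta_Pow act_one)

section \<open>Cyclic submodules generated by weight vectors\<close>

definition gen :: "'v \<Rightarrow> 'v set" where
  "gen u = vs.span {mact M t u | t. t \<in> planar_rook m}"

lemma submodule_gen:
  assumes "u \<in> mcarrier M"
  shows "submodule (gen u)"
  unfolding is_submodule_def
proof (intro conjI ballI)
  show sub: "gen u \<subseteq> mcarrier M"
    unfolding gen_def using assms act_closed carrier_subspace by (intro vs.span_minimal) auto
  show "vs.subspace (gen u)" by (simp add: gen_def)
  show "mact M s ` gen u \<subseteq> gen u" if s: "s \<in> planar_rook m" for s
  proof (rule image_subsetI)
    fix x assume "x \<in> gen u"
    then have "x \<in> vs.span {mact M t u | t. t \<in> planar_rook m}" by (simp add: gen_def)
    then have "x \<in> mcarrier M \<and> mact M s x \<in> gen u"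
    proof (induction rule: vs.span_induct_alt)
      case base
      then show ?case
        using s vs.subspace_0[OF carrier_subspace] by (simp add: gen_def vs.span_zero)
    next
      case (step c x y)
      then obtain t where t: "t \<in> planar_rook m" "x = mact M t u" by blast
      have "mact M s x = mact M (s \<circ>\<^sub>m t) u" using act_comp[OF s t(1) assms] t(2) by simp
      then have "mact M s x \<in> gen u"
        unfolding gen_def using planar_rook_comp[OF s t(1)] by (auto intro: vs.span_base)
      moreover have "x \<in> mcarrier M" using act_closed[OF t(1) assms] t(2) by simp
      ultimately show ?case
        using step s carrier_subspace
        by (auto simp: act_add act_scale vs.subspace_scale vs.subspace_add gen_def
            intro!: vs.span_add vs.span_scale)
    qed
    then show "mact M s x \<in> gen u" by blast
  qed
qed

lemma gen_self: "u \<in> mcarrier M \<Longrightarrow> u \<in> gen u"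
  unfolding gen_def using act_one[of u] pid_planar_rook[of "{1..m}" m]
  by (intro vs.span_base) force

lemma gen_least: "submodule U \<Longrightarrow> u \<in> U \<Longrightarrow> gen u \<subseteq> U"
  unfolding gen_def using submodule_act submodule_subspace by (intro vs.span_minimal) auto

text \<open>Since the order-preserving bijections of \<open>A\<close> are trivial, this is the character by which the
  corner of the monoid algebra at the idempotent \<open>eta A\<close> acts.\<close>

definition kappa :: "nat set \<Rightarrow> (nat \<rightharpoonup> nat) \<Rightarrow> 'k" where
  "kappa A t = (if t |` A = pid A then 1 else 0)"

text \<open>If not zero, \<open>mact M t u\<close> has as weight the image of \<open>A\<close> under
  \<open>t\<close>, which has as many elements as \<open>A\<close>. The last hypothesis leaves for
  \<open>D\<close> only \<open>A\<close> itself or a set of another cardinality; so a component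
  survives only if \<open>D = A\<close> and \<open>t\<close> maps \<open>A\<close> onto itself, and
  then \<open>t\<close> is the identity on \<open>A\<close>.\<close>

lemma eta_act:
  assumes "u \<in> weight A" "A \<subseteq> {1..m}" "D \<subseteq> {1..m}" "t \<in> planar_rook m"
    and "card D = card A \<Longrightarrow> D = A"
  shows "eta M D (mact M t u) = (if D = A then mscale M (kappa A t) u else 0)"
proof (cases "A \<subseteq> dom t")
  case False
  then have "t |` A \<noteq> pid A" by (metis Int_iff dom_pid dom_restrict subsetI)
  then show ?thesis
    using act_weight_eq_0[OF assms(1,2,4) False] eta_zero[OF assms(3)] by (simp add: kappa_def)
next
  case True
  let ?R = "ran (t |` A)"
  have R: "?R \<subseteq> {1..m}"
    using planar_rook_restrict[OF assms(4,2)] by (simp add: planar_rook_def)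
  have w: "mact M t u \<in> weight ?R" by (rule act_weight[OF assms(1,2,4) True])
  have "card ?R = card A"
  proof -
    have "?R = (\<lambda>x. the (t x)) ` A"
      using True by (force simp: ran_def restrict_map_def image_iff split: if_splits)
    moreover have "inj_on (\<lambda>x. the (t x)) A"
    proof (rule inj_onI)
      fix x y assume xy: "x \<in> A" "y \<in> A" "the (t x) = the (t y)"
      then have "t x = t y" using True by (metis domIff option.expand subsetD)
      moreover have "inj_on t (dom t)" using assms(4) by (simp add: planar_rook_def)
      ultimately show "x = y" using True xy by (meson inj_onD subsetD)
    qed
    ultimately show ?thesis by (simp add: card_image)
  qed
  then have DR: "D = ?R \<longleftrightarrow> D = A \<and> ?R = A" using assms(5) by auto
  have eq: "eta M D (mact M t u) = (if D = ?R then mact M t u else 0)"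
    by (rule eta_of_weight[OF w R assms(3)])
  show ?thesis
  proof (cases "?R = A")
    case RA: True
    then have tA: "t |` A = pid A" by (rule planar_rook_restrict_self[OF assms(4) True])
    then have "mact M t u = u"
      using act_pid_comp[OF assms(2,4) weight_carrier[OF assms(1)]] act_pid_weight[OF assms(1,2,2)]
      by simp
    then show ?thesis using eq RA tA by (simp add: kappa_def)
  next
    case False
    then have "t |` A \<noteq> pid A" by (metis ran_pid)
    then show ?thesis using eq DR False by (simp add: kappa_def)
  qed
qed

lemma eta_gen:
  assumes "u \<in> weight A" "A \<subseteq> {1..m}" "D \<subseteq> {1..m}" "x \<in> gen u"
    and "card D = card A \<Longrightarrow> D = A"
  shows "eta M D x \<in> (if D = A then vs.span {u} else {0})"
proof -
  have "x \<in> vs.span {mact M t u | t. t \<in> planar_rook m}" using assms(4) by (simp add: gen_def)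
  then have "x \<in> mcarrier M \<and> eta M D x \<in> (if D = A then vs.span {u} else {0})"
  proof (induction rule: vs.span_induct_alt)
    case base
    then show ?case
      using vs.subspace_0[OF carrier_subspace] eta_zero[OF assms(3)] by (simp add: vs.span_zero)
  next
    case (step c x y)
    then obtain t where t: "t \<in> planar_rook m" "x = mact M t u" by blast
    have x: "x \<in> mcarrier M" using act_closed[OF t(1) weight_carrier[OF assms(1)]] t(2) by simp
    then have "eta M D (mscale M c x + y) = mscale M c (eta M D x) + eta M D y"
      using step assms(3) carrier_subspace by (simp add: eta_add eta_scale vs.subspace_scale)
    moreover have "eta M D x = (if D = A then mscale M (kappa A t) u else 0)"
      using eta_act[OF assms(1-3) t(1) assms(5)] t(2) by simp
    moreover have "mscale M c x + y \<in> mcarrier M"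
      using step x carrier_subspace by (simp add: vs.subspace_scale vs.subspace_add)
    ultimately show ?case
      using step(2) by (cases "D = A") (auto intro!: vs.span_add vs.span_scale intro: vs.span_base)
  qed
  then show ?thesis by blast
qed

text \<open>Diagrams act on \<open>u\<close> by scalars as far as the component at \<open>A\<close>
  is concerned, so the cyclic module has just the line of \<open>u\<close> there and nothing at
  other cardinalities. For \<open>u \<noteq> 0\<close> this will give \<open>gen u\<close> length
  one.\<close>

lemma gen_Int_weight:
  assumes "u \<in> weight A" "A \<subseteq> {1..m}" "D \<subseteq> {1..m}" "card D = card A \<Longrightarrow> D = A"
  shows "gen u \<inter> weight D = (if D = A then vs.span {u} else {0})"
proof
  show "gen u \<inter> weight D \<subseteq> (if D = A then vs.span {u} else {0})"
  proof
    fix x assume "x \<in> gen u \<inter> weight D"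
    then show "x \<in> (if D = A then vs.span {u} else {0})"
      using eta_gen[OF assms(1-3) _ assms(4), of x] eta_of_weight[OF _ assms(3,3), of x] by simp
  qed
  have sub: "submodule (gen u)" using submodule_gen weight_carrier assms(1) by blast
  have "u \<in> gen u" using gen_self weight_carrier assms(1) by blast
  then have "vs.span {u} \<subseteq> gen u \<inter> weight A"
    using assms(1,2) submodule_subspace[OF sub] subspace_weight
    by (intro vs.span_minimal vs.subspace_inter) auto
  moreover have "0 \<in> gen u \<inter> weight D"
    using submodule_subspace[OF sub] subspace_weight[OF assms(3)] vs.subspace_0 by auto
  ultimately show "(if D = A then vs.span {u} else {0}) \<subseteq> gen u \<inter> weight D" by auto
qed

section \<open>Weight spaces of equal cardinality are isomorphic\<close>

lemma weight_iso:
  assumes "A \<subseteq> {1..m}" "B \<subseteq> {1..m}" "card A = card B"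
  obtains s t where "s \<in> planar_rook m" "t \<in> planar_rook m"
    "\<And>v. v \<in> weight A \<Longrightarrow> mact M s v \<in> weight B \<and> mact M t (mact M s v) = v"
    "\<And>v. v \<in> weight B \<Longrightarrow> mact M t v \<in> weight A \<and> mact M s (mact M t v) = v"
proof -
  obtain s t where st: "s \<in> planar_rook m" "t \<in> planar_rook m" "dom s = A" "dom t = B"
    "t \<circ>\<^sub>m s = pid A" "s \<circ>\<^sub>m t = pid B"
    using planar_rook_iso[OF assms] by metis
  \<comment> \<open>Each range is the domain of the other diagram: a composite that is the identity
    on the domain of its inner map puts this domain into the range of the outer map, and the range
    of the inner map into the domain of the outer one.\<close>
  have ran: "ran s = B" "ran t = A"
  proof -
    have sub: "dom p \<subseteq> ran q" if "p \<circ>\<^sub>m q = pid C" "q \<circ>\<^sub>m p = pid (dom p)" for p q :: "nat \<rightharpoonup> nat" and C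
    proof
      fix x assume "x \<in> dom p"
      then have "(q \<circ>\<^sub>m p) x = Some x" using that(2) by (simp add: pid_def)
      then show "x \<in> ran q" by (auto simp: map_comp_def ran_def split: option.splits)
    qed
    have sup: "ran q \<subseteq> dom p" if "p \<circ>\<^sub>m q = pid (dom q)" for p q :: "nat \<rightharpoonup> nat"
    proof
      fix y assume "y \<in> ran q"
      then obtain x where x: "q x = Some y" by (auto simp: ran_def)
      then have "(p \<circ>\<^sub>m q) x = Some x" using that by (auto simp: pid_def dom_def)
      then show "y \<in> dom p" using x by (auto simp: map_comp_def)
    qed
    show "ran s = B" "ran t = A"
      using sub[of t s A] sup[of t s] sub[of s t B] sup[of s t] st by auto
  qed
  have A: "mact M s v \<in> weight B" "mact M t (mact M s v) = v" if "v \<in> weight A" for v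
    using act_weight[OF that assms(1) st(1)] st ran act_comp[OF st(2,1) weight_carrier[OF that]]
      act_pid_weight[OF that assms(1,1)] by (auto simp: restrict_map_dom_self)
  have B: "mact M t v \<in> weight A" "mact M s (mact M t v) = v" if "v \<in> weight B" for v
    using act_weight[OF that assms(2) st(2)] st ran act_comp[OF st(1,2) weight_carrier[OF that]]
      act_pid_weight[OF that assms(2,2)] by (auto simp: restrict_map_dom_self)
  show ?thesis using that[OF st(1,2)] A B by blast
qed

lemma dim_weight_eq:
  assumes "A \<subseteq> {1..m}" "B \<subseteq> {1..m}" "card A = card B"
  shows "vs.dim (weight A) = vs.dim (weight B)"
proof -
  obtain s t where st: "s \<in> planar_rook m" "t \<in> planar_rook m"
    "\<And>v. v \<in> weight A \<Longrightarrow> mact M s v \<in> weight B \<and> mact M t (mact M s v) = v"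
    "\<And>v. v \<in> weight B \<Longrightarrow> mact M t v \<in> weight A \<and> mact M s (mact M t v) = v"
    using weight_iso[OF assms] by metis
  have "bij_betw (mact M s) (weight A) (weight B)"
    by (rule bij_betw_byWitness[of _ "mact M t"]) (use st in auto)
  then show ?thesis
    using vs.dim_bij[OF subspace_weight[OF assms(1)]] act_add[OF st(1)] act_scale[OF st(1)]
      weight_carrier by metis
qed

end

section \<open>Semisimplicity and lengths\<close>

text \<open>The set \<open>A l\<close> represents all weights of cardinality \<open>l\<close>. The
  family is a parameter so that it can follow the given idempotents and be shared by a module and
  all its tensor powers.\<close>

locale prook_fd_module = prook_module +
  fixes A :: "nat \<Rightarrow> nat set"
  assumes fin_dim: "fin_dim M"
    and A_subset: "l \<le> m \<Longrightarrow> A l \<subseteq> {1..m}" and card_A: "l \<le> m \<Longrightarrow> card (A l) = l"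
begin

section \<open>Comparison and splitting of submodules\<close>

lemma A_eq_iff: "l \<le> m \<Longrightarrow> l' \<le> m \<Longrightarrow> card (A l) = card (A l') \<Longrightarrow> A l = A l'"
  by (simp add: card_A)

text \<open>Each component \<open>eta M B x\<close> can be moved by a diagram to the representative
  weight space of its cardinality, compared there, and moved back; \<open>x\<close> is the sum of
  its components.\<close>

lemma submodule_eqI:
  assumes "submodule U" "submodule W" "W \<subseteq> U"
    and "\<And>l v. l \<le> m \<Longrightarrow> v \<in> U \<Longrightarrow> v \<in> weight (A l) \<Longrightarrow> v \<in> W"
  shows "W = U"
proof
  show "U \<subseteq> W"
  proof
    fix x assume x: "x \<in> U"
    have "eta M B x \<in> W" if B: "B \<in> Pow {1..m}" for B
    proof -
      have l: "card B \<le> m" using B card_mono[of "{1..m}" B] by auto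
      obtain s t where st: "s \<in> planar_rook m" "t \<in> planar_rook m"
        "\<And>v. v \<in> weight B \<Longrightarrow> mact M s v \<in> weight (A (card B)) \<and> mact M t (mact M s v) = v"
        using weight_iso[of B "A (card B)"] B A_subset[OF l] card_A[OF l] by (metis PowD)
      have "eta M B x \<in> U" "eta M B x \<in> weight B"
        using eta_submodule[OF assms(1) x] eta_weight submodule_carrier[OF assms(1) x] B by auto
      then show ?thesis
        using st submodule_act[OF assms(1) st(1)] submodule_act[OF assms(2) st(2)]
          assms(4)[OF l] by metis
    qed
    then have "(\<Sum>B\<in>Pow {1..m}. eta M B x) \<in> W"
      by (rule vs.subspace_sum[OF submodule_subspace[OF assms(2)]])
    then show "x \<in> W" using sum_eta submodule_carrier[OF assms(1) x] by simp
  qed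
qed (rule assms(3))

text \<open>This is the source of semisimplicity. Choose \<open>u\<close> of weight
  \<open>A l\<close> in \<open>U\<close> but not in \<open>W\<close>, and a hyperplane
  \<open>H\<close> of the weight space of \<open>U\<close> that contains that of \<open>W\<close>
  and avoids \<open>u\<close>. The cyclic module of \<open>u\<close> is complemented by the largest
  submodule of \<open>U\<close> whose components at \<open>A l\<close> lie in
  \<open>H\<close>.\<close>

lemma split_submodule:
  assumes U: "submodule U" and W: "submodule W" and "W \<subseteq> U" "W \<noteq> U"
  obtains l u Y X where "l \<le> m" "u \<in> U" "u \<in> weight (A l)" "u \<notin> Y"
    "submodule X" "submodule Y" "W \<subseteq> Y" "X \<inter> Y = {0}" "U = {x + y | x y. x \<in> X \<and> y \<in> Y}"
    "X \<inter> weight (A l) = vs.span {u}" "\<forall>l'\<le>m. l' \<noteq> l \<longrightarrow> X \<inter> weight (A l') = {0}"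
proof -
  obtain l u where l: "l \<le> m" and u: "u \<in> U" "u \<in> weight (A l)" "u \<notin> W"
    using submodule_eqI[OF U W] assms(3,4) by blast
  note Al = A_subset[OF l]
  define P where "P = U \<inter> weight (A l)"
  have "vs.subspace P" "vs.subspace (W \<inter> weight (A l))"
    unfolding P_def using U W submodule_subspace subspace_weight[OF Al] vs.subspace_inter by blast+
  then obtain H where H: "vs.subspace H" "W \<inter> weight (A l) \<subseteq> H" "H \<subseteq> P" "u \<notin> H"
    "\<And>p. p \<in> P \<Longrightarrow> \<exists>c. p - mscale M c u \<in> H"
    using vs.hyperplane_exists[of P "W \<inter> weight (A l)" u] u assms(3) unfolding P_def by blast
  define X where "X = gen u"
  \<comment> \<open>Quantifying over all diagrams \<open>t\<close> makes \<open>Y\<close> stable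
    under the action; the identity diagram among them yields the condition on \<open>x\<close>
    itself.\<close>
  define Y where "Y = {x \<in> U. \<forall>t\<in>planar_rook m. eta M (A l) (mact M t x) \<in> H}"
  have uC: "u \<in> mcarrier M" using u weight_carrier by blast
  have X: "submodule X" "X \<subseteq> U"
    unfolding X_def using submodule_gen[OF uC] gen_least[OF U u(1)] by auto
  have UC: "x \<in> mcarrier M" if "x \<in> U" for x using that submodule_carrier[OF U] by blast
  have Y: "submodule Y"
    unfolding is_submodule_def vs.subspace_def
  proof (intro conjI ballI allI)
    show "Y \<subseteq> mcarrier M" using UC by (auto simp: Y_def)
    show "0 \<in> Y"
      using vs.subspace_0[OF H(1)] vs.subspace_0[OF submodule_subspace[OF U]] eta_zero[OF Al]
      by (simp add: Y_def)
    show "x + y \<in> Y" if "x \<in> Y" "y \<in> Y" for x y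
      using that vs.subspace_add[OF H(1)] vs.subspace_add[OF submodule_subspace[OF U]] UC
      by (simp add: Y_def act_add eta_add[OF _ _ Al] act_closed)
    show "mscale M c x \<in> Y" if "x \<in> Y" for c x
      using that vs.subspace_scale[OF H(1)] vs.subspace_scale[OF submodule_subspace[OF U]] UC
      by (simp add: Y_def act_scale eta_scale[OF _ Al] act_closed)
    show "mact M s ` Y \<subseteq> Y" if s: "s \<in> planar_rook m" for s
    proof (rule image_subsetI)
      fix x assume x: "x \<in> Y"
      then have xU: "x \<in> U" by (simp add: Y_def)
      have "eta M (A l) (mact M t (mact M s x)) \<in> H" if t: "t \<in> planar_rook m" for t
        using x planar_rook_comp[OF t s] act_comp[OF t s UC[OF xU]] by (auto simp: Y_def)
      then show "mact M s x \<in> Y" using submodule_act[OF U s xU] by (simp add: Y_def)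
    qed
  qed
  have fixed: "eta M (A l) (mact M (pid {1..m}) v) = v" if "v \<in> weight (A l)" for v
    using act_one[OF weight_carrier[OF that]] eta_of_weight[OF that Al Al] by simp
  have YH: "v \<in> H" if "v \<in> Y" "v \<in> weight (A l)" for v
  proof -
    have "eta M (A l) (mact M (pid {1..m}) v) \<in> H"
      using that(1) pid_planar_rook[of "{1..m}" m] unfolding Y_def by blast
    then show ?thesis by (simp add: fixed[OF that(2)])
  qed
  then have uY: "u \<notin> Y" using u(2) H(4) by blast
  have WY: "W \<subseteq> Y"
  proof
    fix w assume w: "w \<in> W"
    have "eta M (A l) (mact M t w) \<in> H" if t: "t \<in> planar_rook m" for t
      using submodule_act[OF W t w] eta_submodule[OF W _ Al] eta_weight[OF _ Al] H(2)
        submodule_carrier[OF W] by blast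
    then show "w \<in> Y" using w assms(3) by (auto simp: Y_def)
  qed
  have Xl: "X \<inter> weight (A l) = vs.span {u}"
    using gen_Int_weight[OF u(2) Al Al] by (simp add: X_def)
  have Xl': "X \<inter> weight (A l') = {0}" if "l' \<le> m" "l' \<noteq> l" for l'
  proof -
    have "A l' \<noteq> A l" using that l card_A by metis
    then show ?thesis
      using gen_Int_weight[OF u(2) Al A_subset[OF that(1)]] that l card_A by (simp add: X_def)
  qed
  \<comment> \<open>Only the index \<open>l\<close> matters, and there a common vector is a multiple
    of \<open>u\<close> that lies in \<open>H\<close>.\<close>
  have XY: "{0} = X \<inter> Y"
  proof (rule submodule_eqI[OF _ submodule_zero])
    show "submodule (X \<inter> Y)"
      using X(1) Y vs.subspace_inter by (simp add: is_submodule_def image_subset_iff) blast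
    show "{0} \<subseteq> X \<inter> Y" using X(1) Y submodule_subspace vs.subspace_0 by auto
    fix l' v assume l': "l' \<le> m" and v: "v \<in> X \<inter> Y" "v \<in> weight (A l')"
    show "v \<in> {0}"
    proof (cases "l' = l")
      case False
      then show ?thesis using v Xl' l' by blast
    next
      case True
      then have "v \<in> vs.span {u}" using v Xl by blast
      then obtain c where c: "v = mscale M c u" by (auto simp: vs.span_singleton)
      have vH: "v \<in> H"
        using v True YH by blast
      show ?thesis
      proof (cases "c = 0")
        case False
        then have "u = mscale M (inverse c) v" by (simp add: c)
        then have "u \<in> H" using vs.subspace_scale[OF H(1) vH] by simp
        then show ?thesis using H(4) by simp
      qed (simp add: c)
    qed
  qed
  have "{x + y | x y. x \<in> X \<and> y \<in> Y} = U"
  proof (rule submodule_eqI[OF U submodule_sum[OF X(1) Y]])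
    show "{x + y | x y. x \<in> X \<and> y \<in> Y} \<subseteq> U"
      using X(2) vs.subspace_add[OF submodule_subspace[OF U]] by (auto simp: Y_def)
    fix l' v assume l': "l' \<le> m" and v: "v \<in> U" "v \<in> weight (A l')"
    note Al' = A_subset[OF l']
    have "\<exists>x\<in>X. \<exists>y\<in>Y. v = x + y"
    proof (cases "l' = l")
      case False
      \<comment> \<open>No diagram leads from weight \<open>A l'\<close> to a nonzero component at
        \<open>A l\<close>, so these vectors lie entirely in \<open>Y\<close>.\<close>
      have ne: "A l \<noteq> A l'" using False l l' card_A by metis
      have "eta M (A l) (mact M t v) \<in> H" if "t \<in> planar_rook m" for t
        using eta_act[OF v(2) Al' Al that A_eq_iff[OF l l']] ne vs.subspace_0[OF H(1)] by simp
      then have "v \<in> Y" using v(1) by (simp add: Y_def)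
      then show ?thesis
        using vs.subspace_0[OF submodule_subspace[OF X(1)]] by (intro bexI[of _ 0] bexI[of _ v]) auto
    next
      case True
      then obtain c where h: "v - mscale M c u \<in> H" using H(5) v by (auto simp: P_def)
      then have h': "v - mscale M c u \<in> U" "v - mscale M c u \<in> weight (A l)"
        using H(3) by (auto simp: P_def)
      have "v - mscale M c u \<in> Y"
        unfolding Y_def using eta_act[OF h'(2) Al Al] h h'(1) vs.subspace_scale[OF H(1)] by auto
      moreover have "mscale M c u \<in> X"
        unfolding X_def using gen_self[OF uC] by (simp add: gen_def vs.span_scale)
      ultimately show ?thesis
        by (intro bexI[of _ "mscale M c u"] bexI[of _ "v - mscale M c u"]) auto
    qed
    then show "v \<in> {x + y | x y. x \<in> X \<and> y \<in> Y}" by blast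
  qed
  from this[symmetric] show ?thesis
    using that[OF l u(1,2) uY X(1) Y WY XY[symmetric] _ Xl] Xl' by blast
qed

section \<open>Multiplicities and length as dimensions of weight spaces\<close>

definition mult :: "nat \<Rightarrow> 'b set \<Rightarrow> nat" where
  "mult l U = vs.dim (U \<inter> weight (A l))"

definition len :: "'b set \<Rightarrow> nat" where
  "len U = (\<Sum>l\<le>m. mult l U)"

lemma spanning_set: obtains S where "finite S" "vs.span S = mcarrier M"
  using fin_dim by (auto simp: fin_dim_def)

lemma mult_zero [simp]: "l \<le> m \<Longrightarrow> mult l {0} = 0"
  using vs.subspace_0[OF subspace_weight[OF A_subset]] by (simp add: mult_def)

lemma len_zero [simp]: "len {0} = 0"
  by (simp add: len_def)

text \<open>\<open>eta M (A l)\<close> maps \<open>X\<close> and \<open>Y\<close> into themselves,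
  so the decomposition of a weight vector of \<open>U\<close> can be taken inside the weight spaces
  of \<open>X\<close> and \<open>Y\<close>.\<close>

lemma mult_direct_sum:
  assumes "submodule X" "submodule Y" "X \<inter> Y = {0}" "U = {x + y | x y. x \<in> X \<and> y \<in> Y}" "l \<le> m"
  shows "mult l U = mult l X + mult l Y"
proof -
  note Al = A_subset[OF assms(5)]
  have U: "submodule U" using submodule_sum[OF assms(1,2)] assms(4) by simp
  obtain S where S: "finite S" "vs.span S = mcarrier M" by (rule spanning_set)
  have eq: "U \<inter> weight (A l) = {x + y | x y. x \<in> X \<inter> weight (A l) \<and> y \<in> Y \<inter> weight (A l)}"
  proof (intro equalityI subsetI)
    fix v assume v: "v \<in> U \<inter> weight (A l)"
    then obtain x y where xy: "v = x + y" "x \<in> X" "y \<in> Y" using assms(4) by blast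
    have C: "x \<in> mcarrier M" "y \<in> mcarrier M" using xy assms submodule_carrier by blast+
    have "v = eta M (A l) x + eta M (A l) y"
      using eta_of_weight[of v, OF _ Al Al] v eta_add[OF C Al] xy(1) by simp
    then show "v \<in> {x + y | x y. x \<in> X \<inter> weight (A l) \<and> y \<in> Y \<inter> weight (A l)}"
      using eta_submodule[OF assms(1) xy(2) Al] eta_submodule[OF assms(2) xy(3) Al]
        eta_weight[OF C(1) Al] eta_weight[OF C(2) Al] by blast
  next
    fix v assume "v \<in> {x + y | x y. x \<in> X \<inter> weight (A l) \<and> y \<in> Y \<inter> weight (A l)}"
    then show "v \<in> U \<inter> weight (A l)"
      using vs.subspace_add[OF subspace_weight[OF Al]] assms(4) by blast
  qed
  show ?thesis
    unfolding mult_def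
  proof (rule vs.dim_direct_sum[OF _ _ _ eq _ S(1)])
    show "vs.subspace (X \<inter> weight (A l))" "vs.subspace (Y \<inter> weight (A l))"
      using assms(1,2) submodule_subspace subspace_weight[OF Al] vs.subspace_inter by blast+
    show "X \<inter> weight (A l) \<inter> (Y \<inter> weight (A l)) = {0}"
      using assms(3) vs.subspace_0[OF subspace_weight[OF Al]] by blast
    show "U \<inter> weight (A l) \<subseteq> vs.span S" using U S(2) submodule_carrier by blast
  qed
qed

lemma len_direct_sum:
  assumes "submodule X" "submodule Y" "X \<inter> Y = {0}" "U = {x + y | x y. x \<in> X \<and> y \<in> Y}"
  shows "len U = len X + len Y"
  using mult_direct_sum[OF assms] by (simp add: len_def sum.distrib)

lemma len_mono:
  assumes "submodule U" "W \<subseteq> U"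
  shows "len W \<le> len U"
  unfolding len_def mult_def
proof (rule sum_mono)
  fix l assume "l \<in> {..m}"
  then have "vs.subspace (U \<inter> weight (A l))"
    using assms(1) submodule_subspace subspace_weight[OF A_subset] vs.subspace_inter by auto
  moreover obtain S where S: "finite S" "vs.span S = mcarrier M" by (rule spanning_set)
  moreover have "U \<inter> weight (A l) \<subseteq> vs.span S" using S assms submodule_carrier by blast
  ultimately obtain B where B: "finite B" "vs.span B = U \<inter> weight (A l)"
    "card B = vs.dim (U \<inter> weight (A l))"
    using vs.finite_basis_exists by metis
  then show "vs.dim (W \<inter> weight (A l)) \<le> vs.dim (U \<inter> weight (A l))"
    using vs.dim_le_card[of "W \<inter> weight (A l)" B] assms(2) by auto
qed

text \<open>The numerical form of the splitting: passing from \<open>Y\<close> to \<open>U\<close>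
  raises a single multiplicity, by one. The inclusions at the other indices are recorded because
  they tell which weight distinguishes \<open>U\<close> from \<open>Y\<close>.\<close>

lemma split_mult:
  assumes U: "submodule U" and W: "submodule W" and "W \<subseteq> U" "W \<noteq> U"
  obtains l u Y X where "l \<le> m" "u \<in> U" "u \<in> weight (A l)" "u \<notin> Y"
    "submodule X" "submodule Y" "W \<subseteq> Y" "X \<inter> Y = {0}" "U = {x + y | x y. x \<in> X \<and> y \<in> Y}"
    "len X = 1" "mult l U = mult l Y + 1"
    "\<forall>l'\<le>m. l' \<noteq> l \<longrightarrow> mult l' U = mult l' Y \<and> U \<inter> weight (A l') \<subseteq> Y"
proof -
  obtain l u Y X where *: "l \<le> m" "u \<in> U" "u \<in> weight (A l)" "u \<notin> Y"
    "submodule X" "submodule Y" "W \<subseteq> Y" "X \<inter> Y = {0}" "U = {x + y | x y. x \<in> X \<and> y \<in> Y}"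
    "X \<inter> weight (A l) = vs.span {u}" "\<forall>l'\<le>m. l' \<noteq> l \<longrightarrow> X \<inter> weight (A l') = {0}"
    by (rule split_submodule[OF assms]) (rule that)
  have "u \<noteq> 0" using *(4,6) submodule_subspace vs.subspace_0 by blast
  then have l: "mult l X = 1" unfolding mult_def *(10) by (rule vs.dim_line)
  have l': "mult l' X = 0" if "l' \<le> m" "l' \<noteq> l" for l'
    using *(11) that by (simp add: mult_def)
  have "len X = (\<Sum>l'\<le>m. if l' = l then 1 else 0)"
    unfolding len_def using l l' by (intro sum.cong) auto
  also have "\<dots> = 1" using *(1) by simp
  finally have "len X = 1" .
  moreover have "mult l U = mult l Y + 1"
    using mult_direct_sum[OF *(5,6,8,9,1)] l by simp
  moreover have "mult l' U = mult l' Y \<and> U \<inter> weight (A l') \<subseteq> Y" if "l' \<le> m" "l' \<noteq> l" for l'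
  proof
    show "mult l' U = mult l' Y"
      using mult_direct_sum[OF *(5,6,8,9) that(1)] l'[OF that] by simp
    show "U \<inter> weight (A l') \<subseteq> Y"
    proof
      fix v assume v: "v \<in> U \<inter> weight (A l')"
      then obtain x y where xy: "v = x + y" "x \<in> X" "y \<in> Y" using *(9) by blast
      note Al' = A_subset[OF that(1)]
      have C: "x \<in> mcarrier M" "y \<in> mcarrier M" using xy * submodule_carrier by blast+
      have "eta M (A l') x \<in> X \<inter> weight (A l')"
        using eta_submodule[OF *(5) xy(2) Al'] eta_weight[OF C(1) Al'] by simp
      then have "v = eta M (A l') y"
        using eta_of_weight[of v, OF _ Al' Al'] v eta_add[OF C Al'] xy(1) *(11) that by simp
      then show "v \<in> Y" using eta_submodule[OF *(6) xy(3) Al'] by simp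
    qed
  qed
  ultimately show ?thesis using that[OF *(1-9)] by blast
qed

text \<open>\<open>W\<close> lies in the complement \<open>Y\<close> of a summand of length
  one.\<close>

lemma len_strict_mono:
  assumes "submodule U" "submodule W" "W \<subset> U"
  shows "len W < len U"
proof -
  have ne: "W \<subseteq> U" "W \<noteq> U" using assms(3) by auto
  obtain l u Y X where *: "l \<le> m" "u \<in> U" "u \<in> weight (A l)" "u \<notin> Y"
    "submodule X" "submodule Y" "W \<subseteq> Y" "X \<inter> Y = {0}" "U = {x + y | x y. x \<in> X \<and> y \<in> Y}"
    "len X = 1" "mult l U = mult l Y + 1"
    "\<forall>l'\<le>m. l' \<noteq> l \<longrightarrow> mult l' U = mult l' Y \<and> U \<inter> weight (A l') \<subseteq> Y"
    by (rule split_mult[OF assms(1,2) ne]) (rule that)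
  show ?thesis using len_direct_sum[OF *(5,6,8,9)] len_mono[OF *(6,7)] *(10) by simp
qed

lemma len_eq_0: "submodule U \<Longrightarrow> len U = 0 \<Longrightarrow> U = {0}"
  using len_strict_mono[OF _ submodule_zero] vs.subspace_0[OF submodule_subspace]
  by (metis bot.extremum insert_subset less_nat_zero_code psubsetI)

text \<open>Maximality of \<open>W\<close> forces the complement \<open>Y\<close>, which contains
  \<open>W\<close> and misses \<open>u\<close>, to be \<open>W\<close> itself. So a simple factor is
  visible at exactly one index \<open>l\<close>, and \<open>u\<close> represents a nonzero class of
  that weight.\<close>

lemma simple_factor_mult:
  assumes "simple_factor m M U W"
  obtains l u where "l \<le> m" "u \<in> U" "u \<in> weight (A l)" "u \<notin> W" "mult l U = mult l W + 1"
    "\<forall>l'\<le>m. l' \<noteq> l \<longrightarrow> mult l' U = mult l' W \<and> U \<inter> weight (A l') \<subseteq> W"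
proof -
  have UW: "submodule U" "submodule W" "W \<subset> U"
    and max: "\<And>X. submodule X \<Longrightarrow> W \<subseteq> X \<Longrightarrow> X \<subseteq> U \<Longrightarrow> X = W \<or> X = U"
    using assms by (auto simp: simple_factor_def)
  have ne: "W \<subseteq> U" "W \<noteq> U" using UW(3) by auto
  obtain l u Y X where *: "l \<le> m" "u \<in> U" "u \<in> weight (A l)" "u \<notin> Y"
    "submodule X" "submodule Y" "W \<subseteq> Y" "X \<inter> Y = {0}" "U = {x + y | x y. x \<in> X \<and> y \<in> Y}"
    "len X = 1" "mult l U = mult l Y + 1"
    "\<forall>l'\<le>m. l' \<noteq> l \<longrightarrow> mult l' U = mult l' Y \<and> U \<inter> weight (A l') \<subseteq> Y"
    by (rule split_mult[OF UW(1,2) ne]) (rule that)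
  have "0 \<in> X" using *(5) submodule_subspace vs.subspace_0 by blast
  then have "Y \<subseteq> U" unfolding *(9) by force
  then have Y: "Y = W" using max[OF *(6,7)] *(2,4) by blast
  show ?thesis by (rule that[OF *(1-4,11,12)[unfolded Y]])
qed

lemma simple_factor_len:
  assumes "simple_factor m M U W"
  shows "len U = len W + 1"
proof -
  obtain l u where *: "l \<le> m" "u \<in> U" "u \<in> weight (A l)" "u \<notin> W" "mult l U = mult l W + 1"
    "\<forall>l'\<le>m. l' \<noteq> l \<longrightarrow> mult l' U = mult l' W \<and> U \<inter> weight (A l') \<subseteq> W"
    by (rule simple_factor_mult[OF assms]) (rule that)
  have "len U = (\<Sum>l'\<le>m. mult l' W + (if l' = l then 1 else 0))"
    unfolding len_def using *(5,6) by (intro sum.cong) auto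
  then show ?thesis using *(1) by (simp add: len_def sum.distrib)
qed

section \<open>Composition series\<close>

lemma simple_factorI:
  assumes "submodule U" "submodule W" "W \<subset> U" "len U = len W + 1"
  shows "simple_factor m M U W"
  unfolding simple_factor_def using assms len_strict_mono
  by (metis Suc_eq_plus1 not_less_eq psubsetI)

text \<open>Induction on \<open>len\<close> over all submodules: a summand of length one is split
  off, and a series of its complement is extended by \<open>U\<close> on top.\<close>

lemma comp_series_exists: "\<exists>F r. comp_series m M F r"
proof -
  have "\<exists>F r. F 0 = {0} \<and> F r = U \<and> (\<forall>i<r. simple_factor m M (F (Suc i)) (F i))"
    if "submodule U" for U
    using that
  proof (induction "len U" arbitrary: U)
    case 0
    then show ?case using len_eq_0 by (intro exI[of _ "\<lambda>_. {0}"] exI[of _ 0]) auto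
  next
    case (Suc n)
    then have "{0} \<subseteq> U" "{0} \<noteq> U"
      using vs.subspace_0[OF submodule_subspace[OF Suc.prems]] by auto
    obtain l u Y X where s: "l \<le> m" "u \<in> U" "u \<in> weight (A l)" "u \<notin> Y"
    "submodule X" "submodule Y" "{0} \<subseteq> Y" "X \<inter> Y = {0}" "U = {x + y | x y. x \<in> X \<and> y \<in> Y}"
    "len X = 1" "mult l U = mult l Y + 1"
    "\<forall>l'\<le>m. l' \<noteq> l \<longrightarrow> mult l' U = mult l' Y \<and> U \<inter> weight (A l') \<subseteq> Y"
      by (rule split_mult[OF Suc.prems submodule_zero \<open>{0} \<subseteq> U\<close> \<open>{0} \<noteq> U\<close>]) (rule that)
    note * = s(2,4,5,6,8,9,10)
    have "0 \<in> X" using *(3) submodule_subspace vs.subspace_0 by blast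
    then have "Y \<subset> U" using *(1,2) unfolding *(6) by force
    have lenY: "len U = len Y + 1" using len_direct_sum[OF *(3-6)] *(7) by simp
    then have sf: "simple_factor m M U Y" using simple_factorI Suc.prems *(4) \<open>Y \<subset> U\<close> by blast
    obtain F r where F: "F 0 = {0}" "F r = Y" "\<forall>i<r. simple_factor m M (F (Suc i)) (F i)"
      using Suc.hyps(1)[of Y] Suc.hyps(2) lenY *(4) by auto
    show ?case
      by (rule exI[of _ "F(Suc r := U)"], rule exI[of _ "Suc r"]) (use F sf in \<open>auto simp: less_Suc_eq\<close>)
  qed
  then show ?thesis using submodule_whole by (auto simp: comp_series_def)
qed

lemma comp_series_length:
  assumes "comp_series m M F r"
  shows "r = len (mcarrier M)"
proof -
  have "len (F k) = k" if "k \<le> r" for k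
    using that
  proof (induction k)
    case 0
    then show ?case using assms by (simp add: comp_series_def)
  next
    case (Suc k)
    then show ?case using assms simple_factor_len[of "F (Suc k)" "F k"] by (auto simp: comp_series_def)
  qed
  from this[of r] show ?thesis using assms by (simp add: comp_series_def)
qed

lemma comp_length_eq: "comp_length m M = len (mcarrier M)"
  unfolding comp_length_def using comp_series_exists comp_series_length by blast

text \<open>If the factors isomorphic to \<open>S\<close> are exactly those where
  \<open>mult l\<close> jumps, counting them telescopes to a number independent of the series, as
  the \<open>THE\<close> in \<open>comp_mult\<close> requires.\<close>

lemma comp_mult_eq:
  assumes "l \<le> m"
    and "\<And>U W. simple_factor m M U W \<Longrightarrow>
      mult l U = mult l W + (if factor_iso m M U W S then 1 else 0)"
  shows "comp_mult m M S = mult l (mcarrier M)"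
proof -
  have "card {i. i < r \<and> factor_iso m M (F (Suc i)) (F i) S} = mult l (mcarrier M)"
    if F: "comp_series m M F r" for F r
  proof -
    have "card {i. i < k \<and> factor_iso m M (F (Suc i)) (F i) S} = mult l (F k)" if "k \<le> r" for k
      using that
    proof (induction k)
      case 0
      then show ?case using F assms(1) by (simp add: comp_series_def)
    next
      case (Suc k)
      have "{i. i < Suc k \<and> factor_iso m M (F (Suc i)) (F i) S}
        = {i. i < k \<and> factor_iso m M (F (Suc i)) (F i) S} \<union>
          (if factor_iso m M (F (Suc k)) (F k) S then {k} else {})"
        by (auto simp: less_Suc_eq)
      moreover have "simple_factor m M (F (Suc k)) (F k)"
        using F Suc.prems by (simp add: comp_series_def)
      ultimately show ?case
        using Suc assms(2) by auto
    qed
    from this[of r] show ?thesis using F by (simp add: comp_series_def)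
  qed
  then show ?thesis
    unfolding comp_mult_def using comp_series_exists by (intro the_equality) metis+
qed

section \<open>Decompositions into indecomposable summands\<close>

lemma indecomposable_len:
  assumes "submodule U"
  shows "indecomposable m (M\<lparr>mcarrier := U\<rparr>) \<longleftrightarrow> len U = 1"
proof
  assume ind: "indecomposable m (M\<lparr>mcarrier := U\<rparr>)"
  then have "{0} \<subseteq> U" "{0} \<noteq> U"
    using vs.subspace_0[OF submodule_subspace[OF assms]] by (auto simp: indecomposable_def)
  obtain l u Y X where s: "l \<le> m" "u \<in> U" "u \<in> weight (A l)" "u \<notin> Y"
    "submodule X" "submodule Y" "{0} \<subseteq> Y" "X \<inter> Y = {0}" "U = {x + y | x y. x \<in> X \<and> y \<in> Y}"
    "len X = 1" "mult l U = mult l Y + 1"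
    "\<forall>l'\<le>m. l' \<noteq> l \<longrightarrow> mult l' U = mult l' Y \<and> U \<inter> weight (A l') \<subseteq> Y"
    by (rule split_mult[OF assms submodule_zero \<open>{0} \<subseteq> U\<close> \<open>{0} \<noteq> U\<close>]) (rule that)
  note * = s(2,4,5,6,8,9,10)
  have "0 \<in> X" "0 \<in> Y" using *(3,4) submodule_subspace vs.subspace_0 by blast+
  then have "X \<subseteq> U" "Y \<subseteq> U" unfolding *(6) by force+
  \<comment> \<open>\<open>X\<close> has length one, so it is nonzero and indecomposability leaves
    no room for its complement \<open>Y\<close>.\<close>
  then have "X = {0} \<or> Y = {0}"
    using ind *(3-6) is_submodule_restrict[OF assms] by (simp add: indecomposable_def)
  moreover have "X \<noteq> {0}" using *(7) by auto
  ultimately show "len U = 1" using len_direct_sum[OF *(3-6)] *(7) by simp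
next
  assume len: "len U = 1"
  show "indecomposable m (M\<lparr>mcarrier := U\<rparr>)"
    unfolding indecomposable_def is_submodule_restrict[OF assms]
  proof (intro conjI allI impI)
    show "mcarrier (M\<lparr>mcarrier := U\<rparr>) \<noteq> {0}" using len by auto
    fix P Q
    assume "(P \<subseteq> U \<and> submodule P) \<and> (Q \<subseteq> U \<and> submodule Q) \<and> P \<inter> Q = {0} \<and>
      {u + w | u w. u \<in> P \<and> w \<in> Q} = mcarrier (M\<lparr>mcarrier := U\<rparr>)"
    then have PQ: "submodule P" "submodule Q" "len U = len P + len Q"
      using len_direct_sum[of P Q U] by auto
    then have "len P = 0 \<or> len Q = 0" using len by arith
    then show "P = {0} \<or> Q = {0}" using PQ len_eq_0 by blast
  qed
qed

lemma sums_Suc: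
  fixes D :: "nat \<Rightarrow> 'b set"
  shows "{\<Sum>i<Suc r. x i | x. \<forall>i<Suc r. x i \<in> D i}
    = {a + b | a b. a \<in> {\<Sum>i<r. x i | x. \<forall>i<r. x i \<in> D i} \<and> b \<in> D r}"
proof (intro equalityI subsetI)
  fix z assume "z \<in> {a + b | a b. a \<in> {\<Sum>i<r. x i | x. \<forall>i<r. x i \<in> D i} \<and> b \<in> D r}"
  then obtain x b where xb: "z = (\<Sum>i<r. x i) + b" "\<forall>i<r. x i \<in> D i" "b \<in> D r" by blast
  have "z = (\<Sum>i<Suc r. (x(r := b)) i)" using xb(1) by simp
  moreover have "\<forall>i<Suc r. (x(r := b)) i \<in> D i" using xb by (simp add: less_Suc_eq)
  ultimately show "z \<in> {\<Sum>i<Suc r. x i | x. \<forall>i<Suc r. x i \<in> D i}" by blast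
next
  fix z assume "z \<in> {\<Sum>i<Suc r. x i | x. \<forall>i<Suc r. x i \<in> D i}"
  then obtain x where x: "z = (\<Sum>i<r. x i) + x r" "\<forall>i<Suc r. x i \<in> D i" by auto
  then have "\<forall>i<r. x i \<in> D i" "x r \<in> D r" by auto
  then show "z \<in> {a + b | a b. a \<in> {\<Sum>i<r. x i | x. \<forall>i<r. x i \<in> D i} \<and> b \<in> D r}"
    using x(1) by blast
qed

lemma indec_decomp_exists: "\<exists>D r. indec_decomp m M D r"
proof -
  have "\<exists>D (r :: nat). (\<forall>i<r. submodule (D i) \<and> indecomposable m (M\<lparr>mcarrier := D i\<rparr>)) \<and>
     {\<Sum>i<r. x i | x. \<forall>i<r. x i \<in> D i} = U \<and>
     (\<forall>x. (\<forall>i<r. x i \<in> D i) \<and> (\<Sum>i<r. x i) = 0 \<longrightarrow> (\<forall>i<r. x i = 0))"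
    if "submodule U" for U
    using that
  proof (induction "len U" arbitrary: U)
    case 0
    have "U = {0}" using 0 len_eq_0 by metis
    then show ?case by (intro exI[of _ "\<lambda>_. {0}"] exI[of _ 0]) auto
  next
    case (Suc n)
    then have "{0} \<subseteq> U" "{0} \<noteq> U"
      using vs.subspace_0[OF submodule_subspace[OF Suc.prems]] by auto
    obtain l u Y X where s: "l \<le> m" "u \<in> U" "u \<in> weight (A l)" "u \<notin> Y"
    "submodule X" "submodule Y" "{0} \<subseteq> Y" "X \<inter> Y = {0}" "U = {x + y | x y. x \<in> X \<and> y \<in> Y}"
    "len X = 1" "mult l U = mult l Y + 1"
    "\<forall>l'\<le>m. l' \<noteq> l \<longrightarrow> mult l' U = mult l' Y \<and> U \<inter> weight (A l') \<subseteq> Y"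
      by (rule split_mult[OF Suc.prems submodule_zero \<open>{0} \<subseteq> U\<close> \<open>{0} \<noteq> U\<close>]) (rule that)
    note * = s(2,4,5,6,8,9,10)
    have lenY: "len U = len Y + 1" using len_direct_sum[OF *(3-6)] *(7) by simp
    have "n = len Y" using Suc.hyps(2) lenY by simp
    then obtain D and r :: nat where D: "\<forall>i<r. submodule (D i) \<and> indecomposable m (M\<lparr>mcarrier := D i\<rparr>)"
      "{\<Sum>i<r. x i | x. \<forall>i<r. x i \<in> D i} = Y"
      "\<forall>x. (\<forall>i<r. x i \<in> D i) \<and> (\<Sum>i<r. x i) = 0 \<longrightarrow> (\<forall>i<r. x i = 0)"
      using Suc.hyps(1)[OF _ *(4)] by blast
    let ?D = "D(r := X)"
    have "(\<forall>i<Suc r. submodule (?D i) \<and> indecomposable m (M\<lparr>mcarrier := ?D i\<rparr>))"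
      using D(1) *(3,7) indecomposable_len[OF *(3)] by (auto simp: less_Suc_eq)
    moreover have "{\<Sum>i<Suc r. x i | x. \<forall>i<Suc r. x i \<in> ?D i} = U"
    proof -
      have Y: "{\<Sum>i<r. x i | x. \<forall>i<r. x i \<in> ?D i} = Y" using D(2) by simp
      have "{\<Sum>i<Suc r. x i | x. \<forall>i<Suc r. x i \<in> ?D i} = {a + b | a b. a \<in> Y \<and> b \<in> X}"
        unfolding sums_Suc Y by simp
      also have "\<dots> = U"
        unfolding *(6) by (rule Collect_cong) (metis add.commute)
      finally show ?thesis .
    qed
    moreover have "\<forall>i<Suc r. x i = 0"
      if x: "\<forall>i<Suc r. x i \<in> ?D i" "(\<Sum>i<Suc r. x i) = 0" for x
    proof -
      \<comment> \<open>A relation puts \<open>x r\<close> into \<open>X\<close> and also into the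
        sum \<open>Y\<close> of the remaining summands, and these two meet in zero.\<close>
      have Y: "(\<Sum>i<r. x i) \<in> Y" using x(1) D(2) by (auto simp: less_Suc_eq)
      have "x r = - (\<Sum>i<r. x i)" using x(2) by (simp add: eq_neg_iff_add_eq_0 add.commute)
      then have "x r \<in> Y" using vs.subspace_neg[OF submodule_subspace[OF *(4)] Y] by simp
      moreover have "x r \<in> X" using x(1) by auto
      ultimately have "x r = 0" using *(5) by blast
      moreover from this have "\<forall>i<r. x i = 0"
        using x D(3) by (auto simp: less_Suc_eq)
      ultimately show ?thesis by (simp add: less_Suc_eq)
    qed
    ultimately show ?case by blast
  qed
  from this[OF submodule_whole] show ?thesis unfolding indec_decomp_def .
qed

text \<open>The partial sums \<open>T k\<close> grow at each step by a direct summand of length one,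
  so the whole carrier \<open>T r\<close> has length \<open>r\<close>.\<close>

lemma indec_decomp_number:
  assumes "indec_decomp m M D r"
  shows "r = len (mcarrier M)"
proof -
  have D: "\<And>i. i < r \<Longrightarrow> submodule (D i) \<and> len (D i) = 1"
    and sum: "{\<Sum>i<r. x i | x. \<forall>i<r. x i \<in> D i} = mcarrier M"
    and ind: "\<And>x. (\<forall>i<r. x i \<in> D i) \<Longrightarrow> (\<Sum>i<r. x i) = 0 \<Longrightarrow> (\<forall>i<r. x i = 0)"
    using assms indecomposable_len by (auto simp: indec_decomp_def)
  define T where "T k = {\<Sum>i<k. x i | x. \<forall>i<k. x i \<in> D i}" for k
  have "submodule (T k) \<and> len (T k) = k" if "k \<le> r" for k
    using that
  proof (induction k)
    case 0
    have "T 0 = {0}" by (auto simp: T_def)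
    then show ?case using submodule_zero by simp
  next
    case (Suc k)
    have T: "T (Suc k) = {a + b | a b. a \<in> T k \<and> b \<in> D k}"
      unfolding T_def by (rule sums_Suc)
    have Dk: "submodule (D k)" "len (D k) = 1" using D Suc.prems by auto
    have "z = 0" if z: "z \<in> T k" "z \<in> D k" for z
    proof -
      obtain x where x: "z = (\<Sum>i<k. x i)" "\<forall>i<k. x i \<in> D i" using z(1) by (auto simp: T_def)
      \<comment> \<open>A vector \<open>z\<close> common to \<open>T k\<close> and
        \<open>D k\<close> gives the relation \<open>z - z = 0\<close> among the summands; padded by
        zeros, it falls under the directness of the whole decomposition.\<close>
      define y where "y i = (if i < k then x i else if i = k then - z else 0)" for i
      have "(\<Sum>i<r. y i) = (\<Sum>i<Suc k. y i)"
        using Suc.prems by (intro sum.mono_neutral_right) (auto simp: y_def)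
      also have "\<dots> = 0" by (simp add: y_def x(1))
      finally have "(\<Sum>i<r. y i) = 0" .
      moreover have "\<forall>i<r. y i \<in> D i"
        using x(2) D submodule_subspace vs.subspace_0 vs.subspace_neg z(2) by (simp add: y_def)
      ultimately have "y k = 0" using ind Suc.prems by auto
      then show ?thesis by (simp add: y_def)
    qed
    moreover have "0 \<in> T k" "0 \<in> D k"
      using Suc Dk submodule_subspace vs.subspace_0 by auto
    ultimately have "T k \<inter> D k = {0}" by blast
    then show ?case
      using Suc Dk len_direct_sum[OF _ Dk(1) _ T] submodule_sum[OF _ Dk(1), of "T k"] T by simp
  qed
  from this[of r] show ?thesis using sum by (simp add: T_def)
qed

lemma num_indec_eq: "num_indec m M = len (mcarrier M)"
  unfolding num_indec_def using indec_decomp_exists indec_decomp_number by blast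

end

section \<open>Characters and simple modules\<close>

context prook_module
begin

section \<open>Characters in terms of weight multiplicities\<close>

lemma eta_sum:
  "D \<subseteq> {1..m} \<Longrightarrow> (\<And>i. i \<in> I \<Longrightarrow> f i \<in> mcarrier M) \<Longrightarrow>
    eta M D (\<Sum>i\<in>I. f i) = (\<Sum>i\<in>I. eta M D (f i))"
  by (induction I rule: infinite_finite_induct)
    (auto simp: eta_zero eta_add vs.subspace_sum[OF carrier_subspace])

end

context prook_fd_module
begin

text \<open>The sum is direct because \<open>eta M D\<close> fixes \<open>weight D\<close> and
  annihilates all other weight spaces.\<close>

lemma dim_sum_weights:
  assumes "finite I" "I \<subseteq> Pow {1..m}"
  shows "vs.subspace {\<Sum>B\<in>I. x B | x. \<forall>B\<in>I. x B \<in> weight B} \<and>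
    vs.dim {\<Sum>B\<in>I. x B | x. \<forall>B\<in>I. x B \<in> weight B} = (\<Sum>B\<in>I. vs.dim (weight B))"
  using assms
proof (induction I rule: finite_induct)
  case empty
  then show ?case by simp
next
  case (insert D I)
  let ?E = "\<lambda>I. {\<Sum>B\<in>I. x B | x. \<forall>B\<in>I. x B \<in> weight B}"
  have D: "D \<subseteq> {1..m}" and I: "I \<subseteq> Pow {1..m}" using insert.prems by auto
  have IH: "vs.subspace (?E I)" "vs.dim (?E I) = (\<Sum>B\<in>I. vs.dim (weight B))"
    using insert.IH[OF I] by auto
  have eq: "?E (insert D I) = {a + b | a b. a \<in> weight D \<and> b \<in> ?E I}"
  proof (intro equalityI subsetI)
    fix z assume "z \<in> ?E (insert D I)"
    then obtain x where x: "z = (\<Sum>B\<in>insert D I. x B)" "\<forall>B\<in>insert D I. x B \<in> weight B" by blast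
    then have "z = x D + (\<Sum>B\<in>I. x B)" using insert.hyps by simp
    then show "z \<in> {a + b | a b. a \<in> weight D \<and> b \<in> ?E I}" using x(2) by blast
  next
    fix z assume "z \<in> {a + b | a b. a \<in> weight D \<and> b \<in> ?E I}"
    then obtain a x where x: "z = a + (\<Sum>B\<in>I. x B)" "a \<in> weight D" "\<forall>B\<in>I. x B \<in> weight B"
      by blast
    define y where "y = x(D := a)"
    have "(\<Sum>B\<in>I. y B) = (\<Sum>B\<in>I. x B)"
      using insert.hyps by (intro sum.cong) (auto simp: y_def)
    then have "z = (\<Sum>B\<in>insert D I. y B)" using x(1) insert.hyps by (simp add: y_def)
    moreover have "\<forall>B\<in>insert D I. y B \<in> weight B" using x insert.hyps by (auto simp: y_def)
    ultimately show "z \<in> ?E (insert D I)" by blast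
  qed
  have zero: "weight D \<inter> ?E I = {0}"
  proof (intro equalityI subsetI)
    fix z assume z: "z \<in> weight D \<inter> ?E I"
    then obtain x where x: "z = (\<Sum>B\<in>I. x B)" "\<forall>B\<in>I. x B \<in> weight B" by blast
    have "z = eta M D z" using z eta_of_weight[OF _ D D] by simp
    also have "\<dots> = (\<Sum>B\<in>I. eta M D (x B))"
      unfolding x(1) using x(2) weight_carrier by (intro eta_sum[OF D]) blast
    also have "\<dots> = 0"
      using x(2) eta_of_weight[OF _ _ D] insert.hyps I by (intro sum.neutral) fastforce
    finally show "z \<in> {0}" by simp
  qed (use vs.subspace_0[OF subspace_weight[OF D]] vs.subspace_0[OF IH(1)] in auto)
  have sub: "vs.subspace (?E (insert D I))"
    unfolding eq by (rule vs.subspace_sums[OF subspace_weight[OF D] IH(1)])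
  obtain S where S: "finite S" "vs.span S = mcarrier M" by (rule spanning_set)
  have "?E (insert D I) \<subseteq> vs.span S"
    unfolding S(2)
  proof
    fix z assume "z \<in> ?E (insert D I)"
    then obtain x where x: "z = (\<Sum>B\<in>insert D I. x B)" "\<forall>B\<in>insert D I. x B \<in> weight B" by blast
    show "z \<in> mcarrier M"
      unfolding x(1) using x(2) weight_carrier by (intro vs.subspace_sum[OF carrier_subspace]) blast
  qed
  then have "vs.dim (?E (insert D I)) = vs.dim (weight D) + vs.dim (?E I)"
    by (rule vs.dim_direct_sum[OF subspace_weight[OF D] IH(1) zero eq _ S(1)])
  then show ?case using sub IH(2) insert.hyps by simp
qed

lemma image_act_pid:
  assumes "D \<subseteq> {1..m}"
  shows "mact M (pid D) ` mcarrier M = {\<Sum>B\<in>Pow D. x B | x. \<forall>B\<in>Pow D. x B \<in> weight B}"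
proof (intro equalityI subsetI)
  fix z assume "z \<in> mact M (pid D) ` mcarrier M"
  then obtain v where v: "v \<in> mcarrier M" "z = (\<Sum>B\<in>Pow D. eta M B v)"
    using sum_eta_Pow[OF assms] by auto
  moreover have "\<forall>B\<in>Pow D. eta M B v \<in> weight B" using eta_weight[OF v(1)] assms by auto
  ultimately show "z \<in> {\<Sum>B\<in>Pow D. x B | x. \<forall>B\<in>Pow D. x B \<in> weight B}" by blast
next
  fix z assume "z \<in> {\<Sum>B\<in>Pow D. x B | x. \<forall>B\<in>Pow D. x B \<in> weight B}"
  then obtain x where x: "z = (\<Sum>B\<in>Pow D. x B)" "\<forall>B\<in>Pow D. x B \<in> weight B" by blast
  have C: "x B \<in> mcarrier M" if "B \<in> Pow D" for B using x(2) that weight_carrier by blast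
  have "mact M (pid D) z = (\<Sum>B\<in>Pow D. mact M (pid D) (x B))"
    unfolding x(1) by (intro act_sum pid_planar_rook assms C)
  also have "\<dots> = z"
    unfolding x(1)
  proof (rule sum.cong[OF refl])
    fix B assume B: "B \<in> Pow D"
    then have "B \<subseteq> {1..m}" using assms by auto
    then show "mact M (pid D) (x B) = x B"
      using act_pid_weight[of "x B" B D] x(2) B assms by auto
  qed
  finally have "mact M (pid D) z = z" .
  moreover have "z \<in> mcarrier M"
    unfolding x(1) by (rule vs.subspace_sum[OF carrier_subspace C])
  ultimately show "z \<in> mact M (pid D) ` mcarrier M" by (metis imageI)
qed

lemma mult_carrier: "l \<le> m \<Longrightarrow> mult l (mcarrier M) = vs.dim (weight (A l))"
  using weight_carrier by (simp add: mult_def Int_absorb1 subsetI)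

lemma chi_eq:
  assumes "j \<le> m"
  shows "chi M (pid (A j)) = (\<Sum>l\<le>j. (j choose l) * mult l (mcarrier M))"
proof -
  note Aj = A_subset[OF assms]
  have fin: "finite (A j)" using finite_subset_atLeastAtMost[OF Aj] .
  have sub: "Pow (A j) \<subseteq> Pow {1..m}" using Aj by auto
  have "chi M (pid (A j)) = (\<Sum>B\<in>Pow (A j). vs.dim (weight B))"
    unfolding chi_def image_act_pid[OF Aj]
    using dim_sum_weights[OF _ sub] fin by simp
  also have "\<dots> = (\<Sum>B\<in>Pow (A j). mult (card B) (mcarrier M))"
  proof (rule sum.cong[OF refl])
    fix B assume "B \<in> Pow (A j)"
    then have B: "B \<subseteq> {1..m}" using sub by auto
    then have l: "card B \<le> m" using card_mono[of "{1..m}" B] by simp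
    show "vs.dim (weight B) = mult (card B) (mcarrier M)"
      unfolding mult_carrier[OF l] using dim_weight_eq[OF B A_subset[OF l]] card_A[OF l] by simp
  qed
  also have "\<dots> = (\<Sum>l\<le>j. \<Sum>B\<in>{B \<in> Pow (A j). card B = l}. mult (card B) (mcarrier M))"
    using fin card_A[OF assms] card_mono[OF fin]
    by (intro sum.group[symmetric]) auto
  also have "\<dots> = (\<Sum>l\<le>j. (j choose l) * mult l (mcarrier M))"
  proof (rule sum.cong[OF refl])
    fix l
    have "{B \<in> Pow (A j). card B = l} = {B. B \<subseteq> A j \<and> card B = l}" by auto
    then have "card {B \<in> Pow (A j). card B = l} = j choose l"
      using n_subsets[OF fin, of l] card_A[OF assms] by simp
    then show "(\<Sum>B\<in>{B \<in> Pow (A j). card B = l}. mult (card B) (mcarrier M))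
        = (j choose l) * mult l (mcarrier M)"
      by simp
  qed
  finally show ?thesis .
qed

lemma mult_eq_chi:
  assumes "l \<le> m"
  shows "int (mult l (mcarrier M))
    = (\<Sum>j\<le>l. (-1) ^ (l - j) * int (l choose j) * int (chi M (pid (A j))))"
  using binomial_inversion[of l "\<lambda>j. int (chi M (pid (A j)))" "\<lambda>l. int (mult l (mcarrier M))"]
    chi_eq assms by simp

section \<open>Recognizing simple modules by their weight vectors\<close>

lemma simple_mult:
  assumes "is_simple m M" "i \<le> m" "v \<in> weight (A i)" "v \<noteq> 0" "l \<le> m"
  shows "mult l (mcarrier M) = (if l = i then 1 else 0)"
proof -
  have "simple_factor m M (mcarrier M) {0}"
    using assms(1) submodule_zero submodule_whole vs.subspace_0[OF carrier_subspace]
    by (auto simp: is_simple_def simple_factor_def)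
  then obtain l' u where *: "l' \<le> m" "u \<in> mcarrier M" "u \<in> weight (A l')" "u \<notin> {0}"
    "mult l' (mcarrier M) = mult l' {0} + 1"
    "\<forall>l\<le>m. l \<noteq> l' \<longrightarrow> mult l (mcarrier M) = mult l {0} \<and> mcarrier M \<inter> weight (A l) \<subseteq> {0}"
    by (rule simple_factor_mult) (rule that)
  \<comment> \<open>The zero submodule is maximal in a simple module, so only one of the chosen
    weight spaces is nonzero; \<open>v\<close> shows which one.\<close>
  have "i = l'" using *(6) assms(2-4) weight_carrier by blast
  then show ?thesis using *(1,5,6) assms(5) by auto
qed

end

text \<open>Any nonzero vector in the image of \<open>pid D\<close> will do: the partial identities
  on proper subsets of \<open>D\<close> have fewer than \<open>l\<close> strands and vanish on the
  whole module by definition of the apex.\<close>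

lemma simple_with_apex_weight:
  assumes "simple_with_apex m l (pid D) S" "D \<subseteq> {1..m}" "card D = l"
  obtains v where "v \<in> prook_module.weight S D" "v \<noteq> 0"
proof -
  have S: "is_simple m S" "mact S (pid D) ` mcarrier S \<noteq> {0}"
    and kill: "\<And>s v. s \<in> planar_rook m \<Longrightarrow> strands s < l \<Longrightarrow> v \<in> mcarrier S \<Longrightarrow> mact S s v = 0"
    using assms(1) by (auto simp: simple_with_apex_def)
  interpret prook_module m S using S(1) by unfold_locales (simp add: is_simple_def)
  have "0 \<in> mact S (pid D) ` mcarrier S"
    using vs.subspace_0[OF carrier_subspace] act_zero[OF pid_planar_rook[OF assms(2)]] by force
  then obtain v where v: "v \<in> mcarrier S" "mact S (pid D) v \<noteq> 0" using S(2) by blast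
  let ?w = "mact S (pid D) v"
  have w: "?w \<in> mcarrier S" using act_closed[OF pid_planar_rook[OF assms(2)] v(1)] .
  have "mact S (pid D) ?w = ?w"
    using act_pid_comp[OF assms(2) pid_planar_rook[OF assms(2)] v(1)] by (simp add: pid_restrict)
  moreover have "mact S (pid B) ?w = 0" if "B \<subset> D" for B
  proof (rule kill[OF pid_planar_rook _ w])
    show "B \<subseteq> {1..m}" using that assms(2) by auto
    show "strands (pid B) < l"
      using psubset_card_mono[OF finite_subset_atLeastAtMost[OF assms(2)] that] assms(3)
      by (simp add: strands_def)
  qed
  ultimately have "?w \<in> weight D" using w by (simp add: weight_def)
  then show ?thesis using that v(2) by blast
qed

text \<open>For simple modules \<open>U / W\<close> and \<open>S\<close> generated by vectors \<open>u\<close> and \<open>s\<close> of the same weight, this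
  submodule of \<open>U \<times> S\<close> is the graph of a homomorphism, by Goursat's argument.\<close>

inductive iso_graph ::
  "nat \<Rightarrow> ('k, 'v::ab_group_add) pmod \<Rightarrow> ('k, 'w::ab_group_add) pmod \<Rightarrow> 'v set \<Rightarrow> 'v \<Rightarrow> 'w \<Rightarrow>
    'v \<Rightarrow> 'w \<Rightarrow> bool"
  for m M S W u s where
  kernel: "w \<in> W \<Longrightarrow> iso_graph m M S W u s w 0"
| act: "t \<in> planar_rook m \<Longrightarrow> iso_graph m M S W u s (mact M t u) (mact S t s)"
| add: "iso_graph m M S W u s x y \<Longrightarrow> iso_graph m M S W u s x' y' \<Longrightarrow>
    iso_graph m M S W u s (x + x') (y + y')"
| scale: "iso_graph m M S W u s x y \<Longrightarrow> iso_graph m M S W u s (mscale M c x) (mscale S c y)"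

lemma factor_isoI:
  fixes M :: "('k::field, 'v::ab_group_add) pmod" and S :: "('k, 'w::ab_group_add) pmod"
  assumes "is_module m M" "is_simple m S" "simple_factor m M U W" "D \<subseteq> {1..m}"
    and u: "u \<in> U" "u \<notin> W" "u \<in> prook_module.weight M D"
    and s: "s \<noteq> 0" "s \<in> prook_module.weight S D"
  shows "factor_iso m M U W S"
proof -
  interpret M: prook_module m M using assms(1) by unfold_locales
  interpret S: prook_module m S using assms(2) by unfold_locales (simp add: is_simple_def)
  have UW: "M.submodule U" "M.submodule W" "W \<subset> U"
    and max: "\<And>X. M.submodule X \<Longrightarrow> W \<subseteq> X \<Longrightarrow> X \<subseteq> U \<Longrightarrow> X = W \<or> X = U"
    using assms(3) by (auto simp: simple_factor_def)
  have simple: "\<And>X. S.submodule X \<Longrightarrow> X = {0} \<or> X = mcarrier S"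
    using assms(2) by (simp add: is_simple_def)
  have uC: "u \<in> mcarrier M" and sC: "s \<in> mcarrier S"
    using u s M.weight_carrier S.weight_carrier by auto
  let ?G = "iso_graph m M S W u s"
  \<comment> \<open>The invariant that makes the relation a graph: the components of related vectors
    at \<open>D\<close> are multiples of \<open>u\<close> and of \<open>s\<close> by the same
    scalar, up to an element of \<open>W\<close>.\<close>
  have G: "x \<in> U \<and> y \<in> mcarrier S \<and> (\<exists>c. \<exists>w\<in>W. eta M D x = w + mscale M c u \<and> eta S D y = mscale S c s)"
    if "?G x y" for x y
    using that
  proof (induction rule: iso_graph.induct)
    case (kernel w)
    then have "eta M D w = eta M D w + mscale M 0 u \<and> eta S D 0 = mscale S 0 s \<and> eta M D w \<in> W"
      using M.eta_submodule[OF UW(2) _ assms(4)] S.eta_zero[OF assms(4)] by simp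
    then show ?case using kernel UW(3) S.vs.subspace_0[OF S.carrier_subspace] by blast
  next
    case (act t)
    \<comment> \<open>Both coefficients are \<open>kappa D t\<close>, whose value depends on the
      diagram but not on the module.\<close>
    have "eta M D (mact M t u) = 0 + mscale M (M.kappa D t) u"
      "eta S D (mact S t s) = mscale S (M.kappa D t) s"
      using M.eta_act[OF u(3) assms(4,4) act] S.eta_act[OF s(2) assms(4,4) act]
      by (simp_all add: M.kappa_def S.kappa_def)
    then show ?case
      using M.submodule_act[OF UW(1) act u(1)] S.act_closed[OF act sC]
        M.vs.subspace_0[OF M.submodule_subspace[OF UW(2)]] by blast
  next
    case (add x y x' y')
    then obtain c w c' w' where *: "w \<in> W" "eta M D x = w + mscale M c u" "eta S D y = mscale S c s"
      "w' \<in> W" "eta M D x' = w' + mscale M c' u" "eta S D y' = mscale S c' s" by blast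
    have "eta M D (x + x') = (w + w') + mscale M (c + c') u"
      using * add M.eta_add[OF _ _ assms(4)] M.submodule_carrier[OF UW(1)]
      by (simp add: M.vs.scale_left_distrib algebra_simps)
    moreover have "eta S D (y + y') = mscale S (c + c') s"
      using * add S.eta_add[OF _ _ assms(4)] by (simp add: S.vs.scale_left_distrib)
    moreover have "w + w' \<in> W" using * M.vs.subspace_add[OF M.submodule_subspace[OF UW(2)]] by blast
    ultimately show ?case
      using add M.vs.subspace_add[OF M.submodule_subspace[OF UW(1)]]
        S.vs.subspace_add[OF S.carrier_subspace] by blast
  next
    case (scale x y a)
    then obtain c w where *: "w \<in> W" "eta M D x = w + mscale M c u" "eta S D y = mscale S c s" by blast
    have "eta M D (mscale M a x) = mscale M a w + mscale M (a * c) u"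
      using * scale M.eta_scale[OF _ assms(4)] M.submodule_carrier[OF UW(1)]
      by (simp add: M.vs.scale_right_distrib)
    moreover have "eta S D (mscale S a y) = mscale S (a * c) s"
      using * scale S.eta_scale[OF _ assms(4)] by simp
    moreover have "mscale M a w \<in> W"
      using * M.vs.subspace_scale[OF M.submodule_subspace[OF UW(2)]] by blast
    ultimately show ?case
      using scale M.vs.subspace_scale[OF M.submodule_subspace[OF UW(1)]]
        S.vs.subspace_scale[OF S.carrier_subspace] by blast
  qed
  have G_act: "?G (mact M t x) (mact S t y)" if t: "t \<in> planar_rook m" and "?G x y" for t x y
    using that(2)
  proof (induction rule: iso_graph.induct)
    case (kernel w)
    then show ?case
      unfolding S.act_zero[OF t] by (intro iso_graph.kernel M.submodule_act[OF UW(2) t])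
  next
    case (act t')
    then show ?case
      using iso_graph.act[OF planar_rook_comp[OF t act], of M S W u s]
      by (simp add: M.act_comp[OF t act uC] S.act_comp[OF t act sC])
  next
    case (add x y x' y')
    then show ?case
      using G[OF add(1)] G[OF add(2)] M.submodule_carrier[OF UW(1)] iso_graph.add[OF add(3,4)]
      by (simp add: M.act_add[OF t] S.act_add[OF t])
  next
    case (scale x y c)
    then show ?case
      using G[OF scale(1)] M.submodule_carrier[OF UW(1)] iso_graph.scale[OF scale(2)]
      by (simp add: M.act_scale[OF t] S.act_scale[OF t])
  qed
  note G_kernel = iso_graph.kernel[where m = m and M = M and S = S and W = W and u = u and s = s]
    and G_add = iso_graph.add[where m = m and M = M and S = S and W = W and u = u and s = s]
    and G_scale = iso_graph.scale[where m = m and M = M and S = S and W = W and u = u and s = s]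
  have G0: "?G 0 0" using G_kernel M.vs.subspace_0[OF M.submodule_subspace[OF UW(2)]] by blast
  have Gus: "?G u s"
    using iso_graph.act[OF pid_planar_rook[OF subset_refl], of m M S W u s]
    by (simp add: M.act_one[OF uC] S.act_one[OF sC])
  have sub_M: "M.submodule {x. \<exists>y\<in>Y. ?G x y}" if "S.submodule Y" for Y
    unfolding is_submodule_def M.vs.subspace_def
  proof (intro conjI ballI allI)
    show "{x. \<exists>y\<in>Y. ?G x y} \<subseteq> mcarrier M" using G M.submodule_carrier[OF UW(1)] by blast
    show "0 \<in> {x. \<exists>y\<in>Y. ?G x y}"
      using G0 S.vs.subspace_0[OF S.submodule_subspace[OF that]] by blast
    show "x + x' \<in> {x. \<exists>y\<in>Y. ?G x y}" if "x \<in> {x. \<exists>y\<in>Y. ?G x y}" "x' \<in> {x. \<exists>y\<in>Y. ?G x y}" for x x'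
      using that G_add S.vs.subspace_add[OF S.submodule_subspace[OF \<open>S.submodule Y\<close>]] by blast
    show "mscale M c x \<in> {x. \<exists>y\<in>Y. ?G x y}" if "x \<in> {x. \<exists>y\<in>Y. ?G x y}" for c x
      using that G_scale S.vs.subspace_scale[OF S.submodule_subspace[OF \<open>S.submodule Y\<close>]] by blast
    show "mact M t ` {x. \<exists>y\<in>Y. ?G x y} \<subseteq> {x. \<exists>y\<in>Y. ?G x y}" if "t \<in> planar_rook m" for t
      using that G_act S.submodule_act[OF \<open>S.submodule Y\<close>] by blast
  qed
  have sub_S: "S.submodule {y. \<exists>x\<in>X. ?G x y}" if "M.submodule X" for X
    unfolding is_submodule_def S.vs.subspace_def
  proof (intro conjI ballI allI)
    show "{y. \<exists>x\<in>X. ?G x y} \<subseteq> mcarrier S" using G by blast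
    show "0 \<in> {y. \<exists>x\<in>X. ?G x y}"
      using G0 M.vs.subspace_0[OF M.submodule_subspace[OF that]] by blast
    show "y + y' \<in> {y. \<exists>x\<in>X. ?G x y}" if "y \<in> {y. \<exists>x\<in>X. ?G x y}" "y' \<in> {y. \<exists>x\<in>X. ?G x y}" for y y'
      using that G_add M.vs.subspace_add[OF M.submodule_subspace[OF \<open>M.submodule X\<close>]] by blast
    show "mscale S c y \<in> {y. \<exists>x\<in>X. ?G x y}" if "y \<in> {y. \<exists>x\<in>X. ?G x y}" for c y
      using that G_scale M.vs.subspace_scale[OF M.submodule_subspace[OF \<open>M.submodule X\<close>]] by blast
    show "mact S t ` {y. \<exists>x\<in>X. ?G x y} \<subseteq> {y. \<exists>x\<in>X. ?G x y}" if "t \<in> planar_rook m" for t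
      using that G_act M.submodule_act[OF \<open>M.submodule X\<close>] by blast
  qed
  have eta_u: "eta M D u = u" and eta_s: "eta S D s = s"
    using M.eta_of_weight[OF u(3) assms(4,4)] S.eta_of_weight[OF s(2) assms(4,4)] by auto
  \<comment> \<open>The invariant would give \<open>c = 1\<close> and hence
    \<open>u \<in> W\<close>. So the submodule of vectors related to 0 omits \<open>s\<close>, and
    simplicity of \<open>S\<close> makes it zero.\<close>
  have "\<not> ?G 0 s"
  proof
    assume "?G 0 s"
    then obtain c w where *: "w \<in> W" "0 = w + mscale M c u" "s = mscale S c s"
      using G[of 0 s] eta_s M.eta_zero[OF assms(4)] by auto
    have "c = 1" using *(3) s(1) S.vs.scale_cancel_right[of 1 s c] by auto
    then have "u = - w" using *(2) by (simp add: eq_neg_iff_add_eq_0 add.commute)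
    then show False using *(1) u(2) M.vs.subspace_neg[OF M.submodule_subspace[OF UW(2)]] by blast
  qed
  then have fun0: "y = 0" if "?G 0 y" for y
    using simple[OF sub_S[OF M.submodule_zero]] sC that by auto
  have "\<not> ?G u 0"
  proof
    assume "?G u 0"
    then obtain c w where *: "w \<in> W" "u = w + mscale M c u" "0 = mscale S c s"
      using G[of u 0] eta_u S.eta_zero[OF assms(4)] by auto
    then have "c = 0" using s(1) by auto
    then show False using * u(2) by simp
  qed
  \<comment> \<open>The vectors related to \<open>0\<close> in \<open>S\<close> form a submodule
    between \<open>W\<close> and \<open>U\<close> that omits \<open>u\<close>; maximality of
    \<open>W\<close> decides.\<close>
  then have ker: "{x. \<exists>y\<in>{0}. ?G x y} = W"
    using max[OF sub_M[OF S.submodule_zero]] G G_kernel u(1) by auto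
  have dom: "{x. \<exists>y\<in>mcarrier S. ?G x y} = U"
    using max[OF sub_M[OF S.submodule_whole]] G G_kernel Gus u(2)
      S.vs.subspace_0[OF S.carrier_subspace] by blast
  have ran: "{y. \<exists>x\<in>U. ?G x y} = mcarrier S"
    using simple[OF sub_S[OF UW(1)]] Gus u(1) s(1) by blast
  have unique: "y = y'" if "?G x y" "?G x y'" for x y y'
    using fun0[of "y - y'"] G_add[OF that(1) G_scale[OF that(2), of "-1"]] by simp
  define f where "f x = (THE y. ?G x y)" for x
  have f: "f x = y" if "?G x y" for x y
    unfolding f_def using that unique by blast
  have Gf: "?G x (f x)" if "x \<in> U" for x using that dom f by blast
  show ?thesis
    unfolding factor_iso_def
  proof (intro exI[of _ f] conjI ballI)
    show "lin_on (M\<lparr>mcarrier := U\<rparr>) (mscale S) f"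
      unfolding lin_on_def using f[OF G_add[OF Gf Gf]] f[OF G_scale[OF Gf]] by simp
    show "f (mact M t v) = mact S t (f v)" if "t \<in> planar_rook m" "v \<in> U" for t v
      using f[OF G_act[OF that(1) Gf[OF that(2)]]] .
    have "y \<in> f ` U" if y: "y \<in> mcarrier S" for y
    proof -
      obtain x where "x \<in> U" "?G x y" using y ran by blast
      then show ?thesis using f by blast
    qed
    moreover have "f x \<in> mcarrier S" if "x \<in> U" for x using G[OF Gf[OF that]] by blast
    ultimately show "f ` U = mcarrier S" by blast
    have "v \<in> W" if "v \<in> U" "f v = 0" for v
      using Gf[OF that(1)] that(2) ker by auto
    moreover have "f v = 0" if "v \<in> W" for v using f[OF G_kernel[OF that]] .
    ultimately show "{v \<in> U. f v = 0} = W" using UW(3) by blast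
  qed
qed

text \<open>A homomorphism commutes with \<open>eta\<close>, so the component at \<open>D\<close> of
  a preimage of \<open>s\<close> is again a preimage of \<open>s\<close>; it is outside the kernel
  \<open>W\<close> because \<open>s \<noteq> 0\<close>.\<close>

lemma factor_iso_weight:
  fixes M :: "('k::field, 'v::ab_group_add) pmod" and S :: "('k, 'w::ab_group_add) pmod"
  assumes "is_module m M" "is_module m S" "is_submodule m M U" "factor_iso m M U W S" "D \<subseteq> {1..m}"
    and s: "s \<in> prook_module.weight S D" "s \<noteq> 0"
  obtains x where "x \<in> U" "x \<in> prook_module.weight M D" "x \<notin> W"
proof -
  interpret M: prook_module m M using assms(1) by unfold_locales
  interpret S: prook_module m S using assms(2) by unfold_locales
  obtain f where f: "lin_on (M\<lparr>mcarrier := U\<rparr>) (mscale S) f"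
     "\<And>t v. t \<in> planar_rook m \<Longrightarrow> v \<in> U \<Longrightarrow> f (mact M t v) = mact S t (f v)"
     "f ` U = mcarrier S" "{v\<in>U. f v = 0} = W"
    using assms(4) by (auto simp: factor_iso_def)
  note subU = M.submodule_subspace[OF assms(3)]
  have add: "f (v + w) = f v + f w" if "v \<in> U" "w \<in> U" for v w
    using f(1) that by (simp add: lin_on_def)
  have f0: "f 0 = 0" using add[of 0 0] M.vs.subspace_0[OF subU] by simp
  have diff: "f (v - w) = f v - f w" if "v \<in> U" "w \<in> U" for v w
    using add[of "v - w" w] that M.vs.subspace_diff[OF subU] by (simp add: eq_diff_eq)
  have sum: "f (\<Sum>i\<in>I. g i) = (\<Sum>i\<in>I. f (g i))" if "\<And>i. i \<in> I \<Longrightarrow> g i \<in> U" for g and I :: "nat set set"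
    using that by (induction I rule: infinite_finite_induct) (auto simp: f0 add M.vs.subspace_sum[OF subU])
  have eta: "f (eta M B x) = eta S B (f x)" if "B \<subseteq> {1..m}" and x: "x \<in> U" for B x
  proof -
    have "finite B" using that(1) M.finite_subset_atLeastAtMost by blast
    then show ?thesis using that(1)
    proof (induction B rule: finite_psubset_induct)
      case (psubset B)
      have c: "eta M C x \<in> U" if "C \<in> {C. C \<subset> B}" for C
        using that psubset.prems by (intro M.eta_submodule[OF assms(3) x]) auto
      have "f (eta M B x) = f (mact M (pid B) x) - f (\<Sum>C\<in>{C. C \<subset> B}. eta M C x)"
        unfolding M.eta_eq[OF psubset.prems]
        by (intro diff M.submodule_act[OF assms(3) pid_planar_rook[OF psubset.prems] x]
            M.vs.subspace_sum[OF subU c])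
      also have "f (\<Sum>C\<in>{C. C \<subset> B}. eta M C x) = (\<Sum>C\<in>{C. C \<subset> B}. f (eta M C x))"
        by (rule sum[OF c])
      also have "\<dots> = (\<Sum>C\<in>{C. C \<subset> B}. eta S C (f x))"
        using psubset by (intro sum.cong) auto
      finally show ?case
        by (simp add: S.eta_eq[OF psubset.prems] f(2)[OF pid_planar_rook[OF psubset.prems] x])
    qed
  qed
  have "s \<in> f ` U" unfolding f(3) by (rule S.weight_carrier[OF s(1)])
  then obtain x where x: "x \<in> U" "f x = s" by auto
  have "f (eta M D x) = s" using eta[OF assms(5) x(1)] x(2) S.eta_of_weight[OF s(1) assms(5,5)] by simp
  then have "eta M D x \<notin> W" unfolding f(4)[symmetric] using s(2) by simp
  then show ?thesis
    by (rule that[OF M.eta_submodule[OF assms(3) x(1) assms(5)]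
      M.eta_weight[OF M.submodule_carrier[OF assms(3) x(1)] assms(5)]])
qed

text \<open>A simple factor has a nonzero class at exactly one index \<open>l'\<close>, and a common
  weight is both sufficient and necessary for an isomorphism with \<open>S\<close>. So the
  occurrences of \<open>S\<close> are the jumps of \<open>mult l\<close>.\<close>

lemma (in prook_fd_module) comp_mult_apex:
  assumes "l \<le> m" "simple_with_apex m l (pid (A l)) S"
  shows "comp_mult m M S = mult l (mcarrier M)"
proof (rule comp_mult_eq[OF assms(1)])
  fix U W assume sf: "simple_factor m M U W"
  note Al = A_subset[OF assms(1)]
  obtain s where s: "s \<in> prook_module.weight S (A l)" "s \<noteq> 0"
    using simple_with_apex_weight[OF assms(2) Al card_A[OF assms(1)]] .
  have S: "is_simple m S" "is_module m S" using assms(2) by (auto simp: simple_with_apex_def is_simple_def)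
  obtain l' u where *: "l' \<le> m" "u \<in> U" "u \<in> weight (A l')" "u \<notin> W" "mult l' U = mult l' W + 1"
    "\<forall>l\<le>m. l \<noteq> l' \<longrightarrow> mult l U = mult l W \<and> U \<inter> weight (A l) \<subseteq> W"
    by (rule simple_factor_mult[OF sf]) (rule that)
  have "factor_iso m M U W S \<longleftrightarrow> l = l'"
  proof
    assume "factor_iso m M U W S"
    moreover have "submodule U" using sf by (simp add: simple_factor_def)
    ultimately obtain x where "x \<in> U" "x \<in> weight (A l)" "x \<notin> W"
      using factor_iso_weight[OF is_module S(2) _ _ Al s] by blast
    then show "l = l'" using *(6) assms(1) by blast
  next
    assume "l = l'"
    then show "factor_iso m M U W S"
      using factor_isoI[OF is_module S(1) sf Al *(2,4) _ s(2,1)] *(3) by simp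
  qed
  then show "mult l U = mult l W + (if factor_iso m M U W S then 1 else 0)"
    using *(5,6) assms(1) by auto
qed

section \<open>Tensor powers\<close>

interpretation tensor: vector_space tensor_scale
  by unfold_locales (auto simp: tensor_scale_def fun_eq_iff algebra_simps)

section \<open>The diagonal action on tensor powers\<close>

lemma mcarrier_tensor_power:
  "mcarrier (tensor_power M n) =
    tensor.span {pure_tensor M vs | vs. length vs = n \<and> set vs \<subseteq> mcarrier M}"
  and mscale_tensor_power [simp]: "mscale (tensor_power M n) = tensor_scale"
  by (simp_all add: tensor_power_def)

text \<open>The action evaluates a form at modified arguments, so it is linear on the whole function
  space; identities between actions can therefore be checked on pure tensors.\<close>

lemma linear_tensor_act:
  "Vector_Spaces.linear tensor_scale tensor_scale (mact (tensor_power M n) s)"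
  by unfold_locales (auto simp: tensor_power_def tensor_scale_def fun_eq_iff)

lemma sum_fun_apply: "(\<Sum>i\<in>I. f i) x = (\<Sum>i\<in>I. f i x)"
  by (induction I rule: infinite_finite_induct) auto

context prook_module
begin

lemma tensor_act_pure:
  "s \<in> planar_rook m \<Longrightarrow>
    mact (tensor_power M n) s (pure_tensor M vs) = pure_tensor M (map (mact M s) vs)"
  using tensor_power_act_pure[OF is_module] .

lemma tensor_act_closed:
  assumes "s \<in> planar_rook m"
  shows "mact (tensor_power M n) s ` mcarrier (tensor_power M n) \<subseteq> mcarrier (tensor_power M n)"
proof -
  interpret L: Vector_Spaces.linear tensor_scale tensor_scale "mact (tensor_power M n) s"
    by (rule linear_tensor_act)
  show ?thesis
    unfolding mcarrier_tensor_power L.span_image[symmetric]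
  proof (intro tensor.span_mono image_subsetI)
    fix t assume "t \<in> {pure_tensor M vs | vs. length vs = n \<and> set vs \<subseteq> mcarrier M}"
    then obtain vs where vs: "t = pure_tensor M vs" "length vs = n" "set vs \<subseteq> mcarrier M" by blast
    then have "set (map (mact M s) vs) \<subseteq> mcarrier M" using act_closed[OF assms] by auto
    then show "mact (tensor_power M n) s t
        \<in> {pure_tensor M vs | vs. length vs = n \<and> set vs \<subseteq> mcarrier M}"
      using vs tensor_act_pure[OF assms] by (auto intro!: exI[of _ "map (mact M s) vs"])
  qed
qed

lemma is_module_tensor_power: "is_module m (tensor_power M n)"
  unfolding is_module_def mscale_tensor_power
proof (intro conjI ballI)
  interpret pair: vector_space_pair tensor_scale tensor_scale ..
  let ?T = "tensor_power M n"
  let ?P = "{pure_tensor M vs | vs. length vs = n \<and> set vs \<subseteq> mcarrier M}"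
  show "vector_space tensor_scale" ..
  show "tensor.subspace (mcarrier ?T)" by (simp add: mcarrier_tensor_power)
  fix s assume s: "s \<in> planar_rook m"
  show "mact ?T s ` mcarrier ?T \<subseteq> mcarrier ?T" using tensor_act_closed[OF s] .
  show "lin_on ?T tensor_scale (mact ?T s)"
    using linear_tensor_act[of M n s]
    by (auto simp: lin_on_def Vector_Spaces.linear_iff)
  fix t v assume t: "t \<in> planar_rook m" and v: "v \<in> mcarrier ?T"
  interpret S: Vector_Spaces.linear tensor_scale tensor_scale "mact ?T s" by (rule linear_tensor_act)
  have lin: "Vector_Spaces.linear tensor_scale tensor_scale (\<lambda>v. mact ?T s (mact ?T t v))"
    using Vector_Spaces.linear_compose[OF linear_tensor_act linear_tensor_act, of M n s M n t]
    by (simp add: o_def)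
  show "mact ?T (s \<circ>\<^sub>m t) v = mact ?T s (mact ?T t v)"
  proof (rule pair.linear_eq_on[OF linear_tensor_act lin])
    show "v \<in> tensor.span ?P" using v by (simp add: mcarrier_tensor_power)
    fix b assume "b \<in> ?P"
    then obtain vs where vs: "b = pure_tensor M vs" "set vs \<subseteq> mcarrier M" by blast
    then have "map (mact M (s \<circ>\<^sub>m t)) vs = map (mact M s) (map (mact M t) vs)"
      using act_comp[OF s t] by auto
    then show "mact ?T (s \<circ>\<^sub>m t) b = mact ?T s (mact ?T t b)"
      by (simp only: vs(1) tensor_act_pure[OF s] tensor_act_pure[OF t]
          tensor_act_pure[OF planar_rook_comp[OF s t]])
  qed
next
  interpret pair: vector_space_pair tensor_scale tensor_scale ..
  let ?T = "tensor_power M n"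
  let ?P = "{pure_tensor M vs | vs. length vs = n \<and> set vs \<subseteq> mcarrier M}"
  fix v assume v: "v \<in> mcarrier ?T"
  show "mact ?T (prook_one m) v = v"
  proof (rule pair.linear_eq_on[OF linear_tensor_act])
    show "Vector_Spaces.linear tensor_scale tensor_scale (\<lambda>v. v)" by (rule tensor.linear_ident)
    show "v \<in> tensor.span ?P" using v by (simp add: mcarrier_tensor_power)
    fix b assume "b \<in> ?P"
    then obtain vs where vs: "b = pure_tensor M vs" "set vs \<subseteq> mcarrier M" by blast
    have "map (mact M (pid {1..m})) vs = vs"
      using vs(2) act_one by (intro map_idI) auto
    then show "mact ?T (prook_one m) b = b"
      using vs(1) by (simp add: prook_one_eq tensor_act_pure pid_planar_rook)
  qed
qed

text \<open>The tensor products of the vectors of a basis are independent because they are dual to the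
  lists of dual functionals, at which forms can be evaluated.\<close>

lemma tensor_basis:
  assumes "vs.subspace P" "P \<subseteq> mcarrier M" "P \<subseteq> vs.span S" "finite S"
  obtains C where "finite C" "tensor.independent C"
    "tensor.span C = tensor.span {pure_tensor M vs | vs. length vs = n \<and> set vs \<subseteq> P}"
    "card C = vs.dim P ^ n"
proof -
  obtain B where B: "finite B" "vs.independent B" "vs.span B = P" "card B = vs.dim P"
    using vs.finite_basis_exists[OF assms(1,3,4)] by metis
  have BP: "B \<subseteq> P" using B(3) vs.span_superset by blast
  interpret K: vector_space "(*) :: 'k \<Rightarrow> 'k \<Rightarrow> 'k"
    by unfold_locales (auto simp: algebra_simps)
  interpret pair: vector_space_pair "mscale M" "(*) :: 'k \<Rightarrow> 'k \<Rightarrow> 'k" ..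
  have "\<exists>g. Vector_Spaces.linear (mscale M) (*) g \<and> (\<forall>x\<in>B. g x = (if x = b then 1 else 0))" for b
    by (rule pair.linear_independent_extend[OF B(2)])
  then obtain \<phi> where \<phi>: "\<And>b. Vector_Spaces.linear (mscale M) (*) (\<phi> b)"
    "\<And>b x. x \<in> B \<Longrightarrow> \<phi> b x = (if x = b then 1 else 0)" by metis
  have \<phi>_functional: "\<phi> b \<in> functionals M" for b
    using \<phi>(1)[of b] by (auto simp: functionals_def lin_on_def Vector_Spaces.linear_iff)
  define N where "N = {ws. set ws \<subseteq> B \<and> length ws = n}"
  have N: "finite N" "card N = vs.dim P ^ n"
    using finite_lists_length_eq[OF B(1)] card_lists_length_eq[OF B(1)] B(4) by (simp_all add: N_def)
  \<comment> \<open>The pairing is a product of Kronecker deltas, one for each slot.\<close>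
  have dual: "pure_tensor M ws (map \<phi> ws') = (if ws = ws' then 1 else 0)"
    if "ws \<in> N" "ws' \<in> N" for ws ws'
  proof -
    have "pure_tensor M ws (map \<phi> ws') = (\<Prod>i<n. \<phi> (ws' ! i) (ws ! i))"
      using that \<phi>_functional by (auto simp: pure_tensor_def N_def)
    also have "\<dots> = (\<Prod>i<n. if ws ! i = ws' ! i then 1 else 0)"
      using that by (intro prod.cong) (auto simp: \<phi>(2) N_def subset_iff)
    also have "\<dots> = (if ws = ws' then 1 else 0)"
      using that by (auto simp: N_def list_eq_iff_nth_eq prod_zero_iff)
    finally show ?thesis .
  qed
  have inj: "inj_on (pure_tensor M) N"
  proof (rule inj_onI)
    fix ws ws' assume "ws \<in> N" "ws' \<in> N" "pure_tensor M ws = pure_tensor M ws'"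
    then show "ws = ws'" using dual[of ws ws'] dual[of ws' ws'] by (simp split: if_splits)
  qed
  let ?C = "pure_tensor M ` N"
  have "tensor.independent ?C"
  proof (rule tensor.independent_if_scalars_zero)
    show "finite ?C" using N(1) by simp
    fix f x assume zero: "(\<Sum>x\<in>?C. tensor_scale (f x) x) = 0" and "x \<in> ?C"
    then obtain ws' where ws': "ws' \<in> N" "x = pure_tensor M ws'" by blast
    have "0 = (\<Sum>x\<in>?C. tensor_scale (f x) x) (map \<phi> ws')" unfolding zero by simp
    also have "\<dots> = (\<Sum>ws\<in>N. f (pure_tensor M ws) * pure_tensor M ws (map \<phi> ws'))"
      unfolding sum_fun_apply sum.reindex[OF inj] by (simp add: tensor_scale_def)
    also have "\<dots> = (\<Sum>ws\<in>N. if ws = ws' then f (pure_tensor M ws) else 0)"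
      using dual ws'(1) by (intro sum.cong) auto
    also have "\<dots> = f x" using ws' N(1) by simp
    finally show "f x = 0" by simp
  qed
  moreover have "pure_tensor M vs \<in> tensor.span ?C" if "length vs = n" "set vs \<subseteq> P" for vs
  proof -
    \<comment> \<open>The slots from \<open>k\<close> on already contain basis vectors. The
      induction frees one slot at a time, expanding its entry in \<open>B\<close> by multilinearity;
      at \<open>k = n\<close> all entries are arbitrary.\<close>
    have "pure_tensor M vs \<in> tensor.span ?C"
      if "length vs = n" "set vs \<subseteq> P" "\<forall>i<n. k \<le> i \<longrightarrow> vs ! i \<in> B" "k \<le> n" for k vs
      using that
    proof (induction k arbitrary: vs)
      case 0
      then have "vs \<in> N" by (auto simp: N_def in_set_conv_nth)
      then show ?case by (intro tensor.span_base) simp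
    next
      case (Suc k)
      then have k: "k < length vs" by simp
      then have "vs ! k \<in> vs.span B" using Suc.prems B(3) by auto
      then have "vs ! k \<in> P \<and> pure_tensor M (vs[k := vs ! k]) \<in> tensor.span ?C"
      proof (induction rule: vs.span_induct_alt)
        case base
        have "0 \<in> P" using vs.subspace_0[OF assms(1)] .
        then have "pure_tensor M (vs[k := mscale M 0 0]) = tensor_scale 0 (pure_tensor M (vs[k := 0]))"
          using k assms(2) by (intro pure_tensor_scale) auto
        then have "pure_tensor M (vs[k := 0]) = 0" by simp
        then show ?case using \<open>0 \<in> P\<close> tensor.span_zero by metis
      next
        case (step c x y)
        have x: "x \<in> P" using step BP by blast
        have xC: "x \<in> mcarrier M" "mscale M c x \<in> mcarrier M" "y \<in> mcarrier M"
          using x step assms(2) vs.subspace_scale[OF assms(1) x] by auto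
        have "pure_tensor M (vs[k := x]) \<in> tensor.span ?C"
        proof (rule Suc.IH)
          show "set (vs[k := x]) \<subseteq> P" by (intro set_update_subsetI Suc.prems x)
          show "\<forall>i<n. k \<le> i \<longrightarrow> vs[k := x] ! i \<in> B"
            using Suc.prems step(1) k by (auto simp: nth_list_update)
        qed (use Suc.prems in auto)
        then have "tensor_scale c (pure_tensor M (vs[k := x])) + pure_tensor M (vs[k := y])
            \<in> tensor.span ?C"
          using step by (intro tensor.span_add tensor.span_scale) auto
        moreover have "mscale M c x + y \<in> P"
          using x step vs.subspace_add[OF assms(1)] vs.subspace_scale[OF assms(1)] by blast
        ultimately show ?case
          unfolding pure_tensor_add[OF k xC(2,3)] pure_tensor_scale[OF k xC(1)] by blast
      qed
      then show ?case by simp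
    qed
    from this[of vs n] show ?thesis using that by simp
  qed
  then have "tensor.span ?C = tensor.span {pure_tensor M vs | vs. length vs = n \<and> set vs \<subseteq> P}"
    unfolding tensor.span_eq
  proof (intro conjI subsetI)
    fix t assume "t \<in> ?C"
    then show "t \<in> tensor.span {pure_tensor M vs | vs. length vs = n \<and> set vs \<subseteq> P}"
      using BP by (intro tensor.span_base) (auto simp: N_def)
  qed blast
  ultimately show ?thesis
    using that[of ?C] N card_image[OF inj] by simp
qed

section \<open>Finite dimension and character of tensor powers\<close>

lemma fin_dim_tensor_power:
  assumes "fin_dim M"
  shows "fin_dim (tensor_power M n)"
proof -
  obtain S where "finite S" "vs.span S = mcarrier M" using assms by (auto simp: fin_dim_def)
  then obtain C where "finite C"
    "tensor.span C = tensor.span {pure_tensor M vs | vs. length vs = n \<and> set vs \<subseteq> mcarrier M}"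
    using tensor_basis[OF carrier_subspace subset_refl, of S n] by blast
  then show ?thesis unfolding fin_dim_def mscale_tensor_power mcarrier_tensor_power by blast
qed

lemma subspace_image_act:
  assumes "s \<in> planar_rook m"
  shows "vs.subspace (mact M s ` mcarrier M)"
  unfolding vs.subspace_def
proof (intro conjI ballI allI)
  show "0 \<in> mact M s ` mcarrier M"
    using act_zero[OF assms] vs.subspace_0[OF carrier_subspace] by force
  fix x assume "x \<in> mact M s ` mcarrier M"
  then obtain v where v: "v \<in> mcarrier M" "x = mact M s v" by blast
  show "mscale M c x \<in> mact M s ` mcarrier M" for c
    using act_scale[OF assms v(1), of c] v vs.subspace_scale[OF carrier_subspace v(1), of c] by force
  fix y assume "y \<in> mact M s ` mcarrier M"
  then obtain w where w: "w \<in> mcarrier M" "y = mact M s w" by blast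
  show "x + y \<in> mact M s ` mcarrier M"
    using act_add[OF assms v(1) w(1)] v w vs.subspace_add[OF carrier_subspace v(1) w(1)] by force
qed

text \<open>The image of the tensor power under \<open>s\<close> is spanned by the pure tensors with
  entries in the image of the carrier. It is thus the tensor power of that image, and
  \<open>tensor_basis\<close> gives its dimension.\<close>

lemma chi_tensor_power:
  assumes "fin_dim M" "s \<in> planar_rook m"
  shows "chi (tensor_power M n) s = chi M s ^ n"
proof -
  interpret L: Vector_Spaces.linear tensor_scale tensor_scale "mact (tensor_power M n) s"
    by (rule linear_tensor_act)
  obtain S where S: "finite S" "vs.span S = mcarrier M" using assms(1) by (auto simp: fin_dim_def)
  let ?P = "mact M s ` mcarrier M"
  have "mact (tensor_power M n) s ` {pure_tensor M vs | vs. length vs = n \<and> set vs \<subseteq> mcarrier M}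
      = {pure_tensor M vs | vs. length vs = n \<and> set vs \<subseteq> ?P}"
  proof (intro equalityI subsetI)
    fix t assume "t \<in> mact (tensor_power M n) s ` {pure_tensor M vs | vs. length vs = n \<and> set vs \<subseteq> mcarrier M}"
    then obtain vs where vs: "length vs = n" "set vs \<subseteq> mcarrier M"
      "t = pure_tensor M (map (mact M s) vs)"
      using tensor_act_pure[OF assms(2)] by auto
    then show "t \<in> {pure_tensor M vs | vs. length vs = n \<and> set vs \<subseteq> ?P}"
      by (intro CollectI exI[of _ "map (mact M s) vs"]) auto
  next
    fix t assume "t \<in> {pure_tensor M vs | vs. length vs = n \<and> set vs \<subseteq> ?P}"
    then obtain ws where ws: "t = pure_tensor M ws" "length ws = n" "ws \<in> lists ?P" by auto
    then obtain vs where vs: "ws = map (mact M s) vs" "vs \<in> lists (mcarrier M)"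
      unfolding lists_image by blast
    then have "t = mact (tensor_power M n) s (pure_tensor M vs)"
      using ws(1) tensor_act_pure[OF assms(2)] by simp
    then show "t \<in> mact (tensor_power M n) s ` {pure_tensor M vs | vs. length vs = n \<and> set vs \<subseteq> mcarrier M}"
      using vs ws(2) by (intro image_eqI) auto
  qed
  then have im: "mact (tensor_power M n) s ` mcarrier (tensor_power M n)
      = tensor.span {pure_tensor M vs | vs. length vs = n \<and> set vs \<subseteq> ?P}"
    unfolding mcarrier_tensor_power L.span_image[symmetric] by simp
  have P: "?P \<subseteq> mcarrier M" using act_closed[OF assms(2)] by blast
  then have "?P \<subseteq> vs.span S" using S(2) by simp
  then obtain C where "finite C" "tensor.independent C"
    "tensor.span C = tensor.span {pure_tensor M vs | vs. length vs = n \<and> set vs \<subseteq> ?P}"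
    "card C = vs.dim ?P ^ n"
    by (rule tensor_basis[OF subspace_image_act[OF assms(2)] P _ S(1)]) (rule that)
  then show ?thesis
    using tensor.dim_eq_card[of C] by (simp add: chi_def im)
qed

end

section \<open>Asymptotics\<close>

text \<open>Exchanging the sums collects one coefficient \<open>c j\<close> for each power of
  \<open>j choose i\<close>. The coefficient at \<open>j = m\<close> is 1, the other bases are at
  most \<open>(m - 1) choose i\<close>, and \<open>K\<close> sums the absolute values of the other
  coefficients.\<close>

lemma alternating_sum_bound:
  fixes m i :: nat
  obtains K where "K \<ge> 0"
    "\<And>n. \<bar>(\<Sum>l\<le>m. \<Sum>j\<le>l. (-1) ^ (l - j) * real (l choose j) * real (j choose i) ^ n)
      - real (m choose i) ^ n\<bar> \<le> K * real ((m - 1) choose i) ^ n"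
proof
  define c where "c j = (\<Sum>l\<le>m. (-1) ^ (l - j) * real (l choose j))" for j
  define K where "K = (\<Sum>j<m. \<bar>c j\<bar>)"
  show "K \<ge> 0" by (simp add: K_def sum_nonneg)
  fix n
  \<comment> \<open>Terms with \<open>j > l\<close> can be added although \<open>l - j\<close> is
    truncated there: the factor \<open>l choose j\<close> is 0.\<close>
  have "(\<Sum>l\<le>m. \<Sum>j\<le>l. (-1) ^ (l - j) * real (l choose j) * real (j choose i) ^ n)
      = (\<Sum>l\<le>m. \<Sum>j\<le>m. (-1) ^ (l - j) * real (l choose j) * real (j choose i) ^ n)"
    by (intro sum.cong sum.mono_neutral_left) auto
  also have "\<dots> = (\<Sum>j\<le>m. c j * real (j choose i) ^ n)"
    by (subst sum.swap) (simp add: c_def sum_distrib_right)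
  also have "\<dots> = (\<Sum>j<m. c j * real (j choose i) ^ n) + c m * real (m choose i) ^ n"
    by (simp add: lessThan_Suc_atMost[symmetric])
  also have "c m = (\<Sum>l\<in>{m}. (-1) ^ (l - m) * real (l choose m))"
    unfolding c_def by (intro sum.mono_neutral_right) auto
  finally have "\<bar>(\<Sum>l\<le>m. \<Sum>j\<le>l. (-1) ^ (l - j) * real (l choose j) * real (j choose i) ^ n)
      - real (m choose i) ^ n\<bar> = \<bar>\<Sum>j<m. c j * real (j choose i) ^ n\<bar>"
    by simp
  also have "\<dots> \<le> (\<Sum>j<m. \<bar>c j * real (j choose i) ^ n\<bar>)" by (rule sum_abs)
  also have "\<dots> \<le> (\<Sum>j<m. \<bar>c j\<bar> * real ((m - 1) choose i) ^ n)"
  proof (rule sum_mono)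
    fix j assume "j \<in> {..<m}"
    then have "j choose i \<le> (m - 1) choose i" by (intro binomial_right_mono) auto
    then show "\<bar>c j * real (j choose i) ^ n\<bar> \<le> \<bar>c j\<bar> * real ((m - 1) choose i) ^ n"
      by (auto simp: abs_mult intro!: mult_left_mono power_mono)
  qed
  finally show "\<bar>(\<Sum>l\<le>m. \<Sum>j\<le>l. (-1) ^ (l - j) * real (l choose j) * real (j choose i) ^ n)
      - real (m choose i) ^ n\<bar> \<le> K * real ((m - 1) choose i) ^ n"
    by (simp add: K_def sum_distrib_right)
qed

text \<open>Binomial inversion of the constant sequence 1, which comes from the sequence that is 1
  at 0 and 0 elsewhere. It settles the case \<open>i = 0\<close>, where every
  \<open>j choose i\<close> is 1.\<close>

lemma alternating_sum_choose:
  "(\<Sum>l\<le>m. \<Sum>j\<le>l. (-1) ^ (l - j) * int (l choose j)) = 1"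
proof -
  have "(\<Sum>j\<le>l. (-1) ^ (l - j) * int (l choose j)) = (if l = 0 then 1 else 0)" for l
    using binomial_inversion[of l "\<lambda>_. 1" "\<lambda>i. if i = 0 then 1 else 0"]
    by (simp add: if_distrib[of "\<lambda>x. _ * x"] cong: if_cong)
  then show ?thesis by simp
qed

text \<open>The rate is the quotient of \<open>(m - 1) choose i\<close> by the dominant base
  \<open>m choose i\<close>, which is \<open>(m - i) / m\<close> by the absorption identity.\<close>

lemma growth_asymptotics:
  fixes f :: "nat \<Rightarrow> nat"
  assumes "m \<ge> 1" "i \<le> m"
    and f: "\<And>n. n \<ge> 1 \<Longrightarrow> int (f n)
      = (\<Sum>l\<le>m. \<Sum>j\<le>l. (-1) ^ (l - j) * int (l choose j) * int (j choose i) ^ n)"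
  shows "(\<lambda>n. real (f n)) \<sim>[at_top] (\<lambda>n. real (m choose i) ^ n)"
    and "(\<lambda>n. \<bar>real (f n) / real (m choose i) ^ n - 1\<bar>) \<in> O(\<lambda>n. (real (m - i) / real m) ^ n)"
    and "(\<lambda>n. \<bar>real (f n) - real (m choose i) ^ n\<bar>) \<in> O(\<lambda>n. real ((m - 1) choose i) ^ n)"
proof -
  obtain K where K: "K \<ge> 0" and
    bound: "\<And>n. \<bar>(\<Sum>l\<le>m. \<Sum>j\<le>l. (-1) ^ (l - j) * real (l choose j) * real (j choose i) ^ n)
      - real (m choose i) ^ n\<bar> \<le> K * real ((m - 1) choose i) ^ n"
    by (rule alternating_sum_bound[where m = m and i = i]) (rule that)
  have real_f: "real (f n) = (\<Sum>l\<le>m. \<Sum>j\<le>l. (-1) ^ (l - j) * real (l choose j) * real (j choose i) ^ n)"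
    if "n \<ge> 1" for n
    using arg_cong[OF f[OF that], of real_of_int] by simp
  have diff: "\<bar>real (f n) - real (m choose i) ^ n\<bar> \<le> K * real ((m - 1) choose i) ^ n" if "n \<ge> 1" for n
    using bound[of n] real_f[OF that] by simp
  then show "(\<lambda>n. \<bar>real (f n) - real (m choose i) ^ n\<bar>) \<in> O(\<lambda>n. real ((m - 1) choose i) ^ n)"
    by (intro bigoI[of _ K] eventually_at_top_linorderI[of 1]) simp
  have pos: "real (m choose i) > 0" using assms(2) by simp
  have "real (m - i) * real (m choose i) = real m * real ((m - 1) choose i)"
    using binomial_absorb_comp[of m i] by (metis of_nat_mult)
  then have r: "real ((m - 1) choose i) / real (m choose i) = real (m - i) / real m"
    using pos assms(1) by (simp add: field_simps)
  have ratio: "\<bar>real (f n) / real (m choose i) ^ n - 1\<bar> \<le> K * (real (m - i) / real m) ^ n"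
    if "n \<ge> 1" for n
  proof -
    have "real (f n) / real (m choose i) ^ n - 1
        = (real (f n) - real (m choose i) ^ n) / real (m choose i) ^ n"
      using pos by (simp add: diff_divide_distrib)
    then have "\<bar>real (f n) / real (m choose i) ^ n - 1\<bar>
        = \<bar>real (f n) - real (m choose i) ^ n\<bar> / real (m choose i) ^ n"
      by simp
    also have "\<dots> \<le> K * real ((m - 1) choose i) ^ n / real (m choose i) ^ n"
      using diff[OF that] pos by (intro divide_right_mono) auto
    also have "\<dots> = K * (real (m - i) / real m) ^ n"
      by (simp add: power_divide flip: r)
    finally show ?thesis .
  qed
  then show "(\<lambda>n. \<bar>real (f n) / real (m choose i) ^ n - 1\<bar>) \<in> O(\<lambda>n. (real (m - i) / real m) ^ n)"
    by (intro bigoI[of _ K] eventually_at_top_linorderI[of 1]) simp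
  show "(\<lambda>n. real (f n)) \<sim>[at_top] (\<lambda>n. real (m choose i) ^ n)"
  proof (cases "i = 0")
    case True
    \<comment> \<open>For \<open>i = 0\<close> the rate is 1 and the error bound does not tend to 0,
      but the two sides agree exactly from \<open>n = 1\<close> on.\<close>
    have "real (f n) = real (m choose i) ^ n" if "n \<ge> 1" for n
      using f[OF that] alternating_sum_choose[of m] True by simp
    then show ?thesis
      by (intro asymp_equiv_refl_ev eventually_at_top_linorderI[of 1])
  next
    case False
    have "(\<lambda>n. (real (m - i) / real m) ^ n) \<longlonglongrightarrow> 0"
      using False assms(1,2) by (intro LIMSEQ_realpow_zero) auto
    then have "(\<lambda>n. real (f n) / real (m choose i) ^ n - 1) \<longlonglongrightarrow> 0"
      by (rule tendsto_0_le[where K = K], intro eventually_at_top_linorderI[of 1])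
        (use ratio in \<open>simp add: mult.commute\<close>)
    then have "(\<lambda>n. real (f n) / real (m choose i) ^ n) \<longlonglongrightarrow> 1"
      by (simp add: LIM_zero_iff)
    then show ?thesis by (rule asymp_equivI')
  qed
qed

text \<open>The simple modules enter through their apex and not through a construction, and
  \<open>e\<close> is any choice of idempotents, so nothing depends on a particular model of
  them.\<close>

theorem proposition2p2p2:
  fixes m :: nat
    and V :: "('k::alg_closed_field, 'v::ab_group_add) pmod"
    and e :: "nat \<Rightarrow> nat \<rightharpoonup> nat"
  assumes "m \<ge> 1"
    and "is_module m V" and "fin_dim V"
    and "\<forall>j\<le>m. idempotent_in_class m j (e j)"
  shows
    "(\<forall>n\<ge>1. \<forall>l\<le>m. \<forall>S :: ('k, 's::ab_group_add) pmod. simple_with_apex m l (e l) S \<longrightarrow>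
        int (comp_mult m (tensor_power V n) S)
          = (\<Sum>j\<le>l. (-1) ^ (l - j) * int (l choose j) * int (chi V (e j)) ^ n))
     \<and> (\<forall>n\<ge>1. comp_length m (tensor_power V n) = num_indec m (tensor_power V n) \<and>
        int (comp_length m (tensor_power V n))
          = (\<Sum>l\<le>m. \<Sum>j\<le>l. (-1) ^ (l - j) * int (l choose j) * int (chi V (e j)) ^ n))
     \<and> (\<forall>i\<le>m. simple_with_apex m i (e i) V \<longrightarrow>
        mdim V = m choose i \<and>
        (\<lambda>n. real (comp_length m (tensor_power V n))) \<sim>[at_top] (\<lambda>n. real (mdim V) ^ n) \<and>
        (\<lambda>n. \<bar>real (comp_length m (tensor_power V n)) / real (mdim V) ^ n - 1\<bar>)
          \<in> O(\<lambda>n. (real (m - i) / real m) ^ n) \<and>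
        (\<lambda>n. \<bar>real (comp_length m (tensor_power V n)) - real (mdim V) ^ n\<bar>)
          \<in> O(\<lambda>n. real ((m - 1) choose i) ^ n))"
proof -
  define A where "A j = dom (e j)" for j
  have A: "A j \<subseteq> {1..m}" "card (A j) = j" and e: "e j = pid (A j)" if "j \<le> m" for j
    using idempotent_in_class_pid[of m j "e j"] assms(4) that by (auto simp: A_def)
  interpret V: prook_module m V using assms(2) by unfold_locales
  interpret V: prook_fd_module m V A
    using assms(3) A by unfold_locales auto
  have T: "prook_fd_module m (tensor_power V n) A" for n
    using V.is_module_tensor_power V.fin_dim_tensor_power[OF assms(3)] A by unfold_locales auto
  have mult: "int (prook_fd_module.mult (tensor_power V n) A l (mcarrier (tensor_power V n)))
      = (\<Sum>j\<le>l. (-1) ^ (l - j) * int (l choose j) * int (chi V (e j)) ^ n)" if "l \<le> m" for n l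
  proof -
    interpret T: prook_fd_module m "tensor_power V n" A by (rule T)
    have "chi (tensor_power V n) (pid (A j)) = chi V (e j) ^ n" if "j \<le> l" for j
      using V.chi_tensor_power[OF assms(3) pid_planar_rook, of "A j"] A[of j] e[of j] that \<open>l \<le> m\<close>
      by simp
    then show ?thesis using T.mult_eq_chi[OF that] by simp
  qed
  have length: "comp_length m (tensor_power V n) = num_indec m (tensor_power V n) \<and>
      int (comp_length m (tensor_power V n))
        = (\<Sum>l\<le>m. \<Sum>j\<le>l. (-1) ^ (l - j) * int (l choose j) * int (chi V (e j)) ^ n)" for n
  proof -
    interpret T: prook_fd_module m "tensor_power V n" A by (rule T)
    show ?thesis by (simp add: T.comp_length_eq T.num_indec_eq T.len_def mult)
  qed
  have apex: "int (comp_mult m (tensor_power V n) S)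
      = (\<Sum>j\<le>l. (-1) ^ (l - j) * int (l choose j) * int (chi V (e j)) ^ n)"
    if "l \<le> m" "simple_with_apex m l (e l) S" for n l and S :: "('k, 's) pmod"
  proof -
    interpret T: prook_fd_module m "tensor_power V n" A by (rule T)
    show ?thesis using T.comp_mult_apex[OF that(1), of S] that(2) mult[OF that(1)] by (simp add: e[OF that(1)])
  qed
  have simple: "mdim V = m choose i \<and>
      (\<forall>n. int (comp_length m (tensor_power V n))
        = (\<Sum>l\<le>m. \<Sum>j\<le>l. (-1) ^ (l - j) * int (l choose j) * int (j choose i) ^ n))"
    if i: "i \<le> m" "simple_with_apex m i (e i) V" for i
  proof -
    obtain v where v: "v \<in> V.weight (A i)" "v \<noteq> 0"
      using simple_with_apex_weight[of m i "A i" V] i A e by metis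
    have "is_simple m V" using i(2) by (simp add: simple_with_apex_def)
    then have mult_V: "V.mult l (mcarrier V) = (if l = i then 1 else 0)" if "l \<le> m" for l
      using V.simple_mult i(1) v that by blast
    have chi: "chi V (e j) = j choose i" if "j \<le> m" for j
    proof -
      have "chi V (e j) = (\<Sum>l\<le>j. (j choose l) * (if l = i then 1 else 0))"
        unfolding e[OF that] V.chi_eq[OF that] using mult_V that by (intro sum.cong) auto
      also have "\<dots> = j choose i"
        by (simp add: if_distrib[of "\<lambda>x. _ * x"] cong: if_cong)
      finally show ?thesis .
    qed
    \<comment> \<open>The only subset with \<open>m\<close> elements is the whole vertex set, so
      \<open>e m\<close> is the identity diagram and the character at \<open>m\<close> is the
      dimension.\<close>
    have "A m = {1..m}" using A[of m] by (simp add: card_subset_eq)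
    then have "mact V (e m) ` mcarrier V = mcarrier V"
      using e[of m] V.act_one by simp
    then have "mdim V = m choose i" using chi[of m] by (simp add: chi_def mdim_def)
    moreover have "int (comp_length m (tensor_power V n))
        = (\<Sum>l\<le>m. \<Sum>j\<le>l. (-1) ^ (l - j) * int (l choose j) * int (j choose i) ^ n)" for n
      using length[of n] chi by simp
    ultimately show ?thesis by blast
  qed
  have "mdim V = m choose i \<and>
      (\<lambda>n. real (comp_length m (tensor_power V n))) \<sim>[at_top] (\<lambda>n. real (mdim V) ^ n) \<and>
      (\<lambda>n. \<bar>real (comp_length m (tensor_power V n)) / real (mdim V) ^ n - 1\<bar>)
        \<in> O(\<lambda>n. (real (m - i) / real m) ^ n) \<and>
      (\<lambda>n. \<bar>real (comp_length m (tensor_power V n)) - real (mdim V) ^ n\<bar>)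
        \<in> O(\<lambda>n. real ((m - 1) choose i) ^ n)"
    if "i \<le> m" "simple_with_apex m i (e i) V" for i
    using simple[OF that] growth_asymptotics[OF assms(1) that(1), of "\<lambda>n. comp_length m (tensor_power V n)"]
    by simp
  then show ?thesis using apex length by blast
qed

end
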